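(* Let $V$ be a finite-dimensional real inner product space with inner product $(\bullet|\bullet)$, and let $J:V\to V$ be a $(\bullet|\bullet)$-orthogonal complex structure. Let $\mathbb{E}:\bigwedge(V_{\mathbb{C}})\to\mathbb{C}$ be the Berezin expectation determined by $J$, let $\tau:C(V_{\mathbb{C}})\to\mathbb{C}$ be the trace on the complex Clifford algebra, and let $\nu=\nu_J:\bigwedge(V_{\mathbb{C}})\to C(V_{\mathbb{C}})$ be the ($J$-dependent) antinormal ordering isomorphism of super vector spaces. Then $$\mathbb{E}=\tau\circ\nu .$$
   Context: $V$ is a finite-dimensional real vector space with inner product $(\bullet|\bullet)$. Its complexification is $V_{\mathbb{C}}$, with canonical conjugation $w\mapsto\bar w$. The inner product extends to $V_{\mathbb{C}}$ as a complex-bilinear form $(\bullet|\bullet)$ and as a complex inner product $\langle x|y\rangle=(\bar x|y)$ (conjugate-linear in the first variable, linear in the second). Clifford algebra and trace: $C(V_{\mathbb{C}})$ is the unital associative complex algebra generated by $V_{\mathbb{C}}$ subject to $z^2=(z|z)\mathbf{1}$ for all $z\in V_{\mathbb{C}}$; equivalently $xy+yx=2(x|y)\mathbf{1}$ for $x,y\in V_{\mathbb{C}}$. Let $\Gamma$ be the unique automorphism of $C(V_{\mathbb{C}})$ restricting to $-\mathrm{Id}$ on $V_{\mathbb{C}}$; it makes $C(V_{\mathbb{C}})$ a superalgebra. The trace $\tau:C(V_{\mathbb{C}})\to\mathbb{C}$ is the unique linear functional such that $\tau(\mathbf{1})=1$, $\tau\circ\Gamma=\tau$ and $\tau(ab)=\tau(ba)$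 for all $a,b\in C(V_{\mathbb{C}})$. Complex structure: $J:V\to V$ is real-linear, orthogonal for $(\bullet|\bullet)$, and $J^2=-\mathrm{Id}$. It makes $V$ into a complex vector space $V_J$ (with $i$ acting as $J$) carrying the complex inner product $\langle x|y\rangle_J=(x|y)+i(Jx|y)$. Let $M=\dim_{\mathbb{C}}V_J$. Let $J_{\mathbb{C}}$ be the complex-linear extension of $J$ to $V_{\mathbb{C}}$ and put $V_J^{\pm}=\{w\in V_{\mathbb{C}}:J_{\mathbb{C}}w=\pm iw\}$, so $V_{\mathbb{C}}=V_J^-\oplus V_J^+$; each of $V_J^{\pm}$ is totally isotropic for the bilinear form $(\bullet|\bullet)$. For $v\in V_J$ put $\gamma^{+}(v)=v^+=(v-iJv)/\sqrt2\in V_J^+$ and $\gamma^-(v)=v^-=(v+iJv)/\sqrt2\in V_J^-$. Berezin expectation: the element $$\gamma=\sum_{m=1}^M\gamma^+(v_m)\wedge\gamma^-(v_m)\in\bigwedge(V_{\mathbb{C}})$$ is independent of the unitary (i.e. $\langle\bullet|\bullet\rangle_J$-orthonormal complex) basis $v_1,\dots,v_M$ of $V_J$, and $$\omega=\frac{1}{M!}(-\gamma)^M=\gamma^-(v_1)\wedge\gamma^+(v_1)\wedge\cdots\wedge\gamma^-(v_M)\wedge\gamma^+(v_M)$$ is a unit vector in the one-dimensional space $\bigwedge^{2M}(V_{\mathbb{C}})$. Let $\mathbb{P}$ be the orthogonal projector from $\bigwedge(V_{\mathbb{C}})$ (with its canonical determinantal inner product) onto its top exterior power $\bigwedge^{2M}(V_{\mathbb{C}})$,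 i.e. the degree-$2M$ component map. For $\zeta\in\bigwedge(V_{\mathbb{C}})$, the Berezin expectation $\mathbb{E}(\zeta)\in\mathbb{C}$ is defined by $\mathbb{P}(\zeta\wedge e^{-\gamma})=\mathbb{E}(\zeta)\,\omega$, the exponential being taken in the exterior algebra $\bigwedge(V_{\mathbb{C}})$. Antinormal ordering: since $V_J^{\pm}$ is isotropic, the subalgebra of $C(V_{\mathbb{C}})$ generated by $V_J^{\pm}$ is canonically the exterior algebra $\bigwedge(V_J^{\pm})$ (which is also a subalgebra of $\bigwedge(V_{\mathbb{C}})$). The map $\nu=\nu_J$ is the composite of the superalgebra isomorphism $\bigwedge(V_{\mathbb{C}})\to\bigwedge(V_J^-)\otimes\bigwedge(V_J^+)$ inverse to $\alpha\otimes\beta\mapsto\alpha\wedge\beta$, followed by the super vector space isomorphism $\bigwedge(V_J^-)\otimes\bigwedge(V_J^+)\to C(V_{\mathbb{C}})$, $\alpha\otimes\beta\mapsto\alpha\beta$ (Clifford product). Equivalently, $\nu$ is the unique complex-linear map with $\nu(\alpha\wedge\beta)=\alpha\beta$ for all $\alpha\in\bigwedge(V_J^-)$ and $\beta\in\bigwedge(V_J^+)$. *)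

theory Defs
  imports "HOL-Analysis.Analysis" "HOL-Library.Poly_Mapping" "HOL-Library.FuncSet"
begin

section \<open>The complexification\<close>

text \<open>The pair \<open>(x, y)\<close> stands for \<open>x + i y\<close>.\<close>

type_synonym 'a complexification = "'a \<times> 'a"

definition cscale ::
  "complex \<Rightarrow> 'a::real_vector complexification \<Rightarrow> 'a complexification" where
  "cscale c w =
     (Re c *\<^sub>R fst w - Im c *\<^sub>R snd w, Re c *\<^sub>R snd w + Im c *\<^sub>R fst w)"

definition cbilin ::
  "'a::real_inner complexification \<Rightarrow> 'a complexification \<Rightarrow> complex" where
  "cbilin w z =
     Complex (fst w \<bullet> fst z - snd w \<bullet> snd z) (fst w \<bullet> snd z + snd w \<bullet> fst z)"

lemma vector_space_cscale: "vector_space cscale"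
  by unfold_locales (auto simp: cscale_def algebra_simps)


section \<open>Free algebras and their quotients by a quadratic relation\<close>

text \<open>
  Words over \<open>'a\<close> form a monoid, written additively because the convolution product of
  \<^typ>\<open>'k \<Rightarrow>\<^sub>0 complex\<close> requires the additive class on \<open>'k\<close>. Hence
  \<open>'a word \<Rightarrow>\<^sub>0 complex\<close> is the free unital associative complex algebra on the set of
  all elements of \<open>'a\<close>.
\<close>

datatype 'a word = Word (letters: "'a list")

instantiation word :: (type) monoid_add
begin

definition zero_word :: "'a word" where "0 = Word []"

definition plus_word :: "'a word \<Rightarrow> 'a word \<Rightarrow> 'a word" where
  "u + w = Word (letters u @ letters w)"

instance
  by standard (auto simp: zero_word_def plus_word_def)

end

type_synonym 'a free_algebra = "'a word \<Rightarrow>\<^sub>0 complex"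

definition free_const :: "complex \<Rightarrow> 'a free_algebra" where
  "free_const c = Poly_Mapping.single 0 c"

definition free_gen :: "'a \<Rightarrow> 'a free_algebra" where
  "free_gen v = Poly_Mapping.single (Word [v]) 1"

text \<open>
  The two-sided ideal generated by the relations that make the generators depend linearly
  on the vector and by \<open>z\<^sup>2 = q z\<close>.
\<close>

inductive_set quadratic_ideal ::
  "('a::real_vector complexification \<Rightarrow> complex) \<Rightarrow> 'a complexification free_algebra set"
  for q :: "'a complexification \<Rightarrow> complex" where
  gen_add: "free_gen (w + z) - free_gen w - free_gen z \<in> quadratic_ideal q"
| gen_scale: "free_gen (cscale c z) - free_const c * free_gen z \<in> quadratic_ideal q"
| gen_square: "free_gen z * free_gen z - free_const (q z) \<in> quadratic_ideal q"
| zero: "0 \<in> quadratic_ideal q"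
| add: "a \<in> quadratic_ideal q \<Longrightarrow> b \<in> quadratic_ideal q \<Longrightarrow> a + b \<in> quadratic_ideal q"
| mult_left: "a \<in> quadratic_ideal q \<Longrightarrow> x * a \<in> quadratic_ideal q"
| mult_right: "a \<in> quadratic_ideal q \<Longrightarrow> a * x \<in> quadratic_ideal q"

lemma quadratic_ideal_uminus:
  "a \<in> quadratic_ideal q \<Longrightarrow> - a \<in> quadratic_ideal q"
  using quadratic_ideal.mult_left[of a q "- 1"] by simp

lemma quadratic_ideal_diff:
  "a \<in> quadratic_ideal q \<Longrightarrow> b \<in> quadratic_ideal q \<Longrightarrow> a - b \<in> quadratic_ideal q"
  using quadratic_ideal.add[of a q "- b"] quadratic_ideal_uminus[of b q] by simp

lemma equivp_quadratic_ideal: "equivp (\<lambda>a b. a - b \<in> quadratic_ideal q)"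
proof (rule equivpI)
  show "reflp (\<lambda>a b. a - b \<in> quadratic_ideal q)"
    by (auto simp: reflp_def quadratic_ideal.zero)
  show "symp (\<lambda>a b. a - b \<in> quadratic_ideal q)"
    using quadratic_ideal_uminus by (fastforce simp: symp_def)
  show "transp (\<lambda>a b. a - b \<in> quadratic_ideal q)"
    using quadratic_ideal.add by (fastforce simp: transp_def)
qed

lemma quadratic_ideal_cong_add:
  assumes "a - a' \<in> quadratic_ideal q" "b - b' \<in> quadratic_ideal q"
  shows "(a + b) - (a' + b') \<in> quadratic_ideal q"
  using quadratic_ideal.add[OF assms] by (simp add: algebra_simps)

lemma quadratic_ideal_cong_diff:
  assumes "a - a' \<in> quadratic_ideal q" "b - b' \<in> quadratic_ideal q"
  shows "(a - b) - (a' - b') \<in> quadratic_ideal q"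
  using quadratic_ideal_diff[OF assms] by (simp add: algebra_simps)

lemma quadratic_ideal_cong_uminus:
  assumes "a - a' \<in> quadratic_ideal q"
  shows "(- a) - (- a') \<in> quadratic_ideal q"
  using quadratic_ideal_uminus[OF assms] by (simp add: algebra_simps)

lemma quadratic_ideal_cong_mult:
  assumes "a - a' \<in> quadratic_ideal q" "b - b' \<in> quadratic_ideal q"
  shows "a * b - a' * b' \<in> quadratic_ideal q"
proof -
  have "(a - a') * b + a' * (b - b') \<in> quadratic_ideal q"
    using assms by (intro quadratic_ideal.add quadratic_ideal.mult_left quadratic_ideal.mult_right)
  then show ?thesis by (simp add: algebra_simps)
qed


section \<open>The exterior algebra and the Clifford algebra of the complexification\<close>

text \<open>The product in \<open>'a exterior\<close> is the wedge product.\<close>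

quotient_type (overloaded) 'a exterior =
  "'a::real_vector complexification free_algebra" /
  "\<lambda>a b. a - b \<in> quadratic_ideal (\<lambda>_. 0)"
  by (rule equivp_quadratic_ideal)

text \<open>
  The class \<open>ring_1\<close> is avoided in the two instances below only because it contains
  \<open>0 \<noteq> 1\<close>.
\<close>

instantiation exterior :: (real_vector) "{ring, monoid_mult}"
begin

lift_definition zero_exterior :: "'a exterior" is 0 .
lift_definition one_exterior :: "'a exterior" is 1 .
lift_definition plus_exterior :: "'a exterior \<Rightarrow> 'a exterior \<Rightarrow> 'a exterior" is plus
  by (rule quadratic_ideal_cong_add)
lift_definition minus_exterior :: "'a exterior \<Rightarrow> 'a exterior \<Rightarrow> 'a exterior" is minus
  by (rule quadratic_ideal_cong_diff)
lift_definition uminus_exterior :: "'a exterior \<Rightarrow> 'a exterior" is uminus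
  by (rule quadratic_ideal_cong_uminus)
lift_definition times_exterior :: "'a exterior \<Rightarrow> 'a exterior \<Rightarrow> 'a exterior" is times
  by (rule quadratic_ideal_cong_mult)

instance
  by standard (transfer, simp add: quadratic_ideal.zero algebra_simps)+

end

lift_definition ext_scale :: "complex \<Rightarrow> 'a::real_vector exterior \<Rightarrow> 'a exterior"
  is "\<lambda>c a. free_const c * a"
  by (metis quadratic_ideal.mult_left right_diff_distrib)

lift_definition ext_vec :: "'a::real_vector complexification \<Rightarrow> 'a exterior" is free_gen .

quotient_type (overloaded) 'a clifford =
  "'a::real_inner complexification free_algebra" /
  "\<lambda>a b. a - b \<in> quadratic_ideal (\<lambda>z. cbilin z z)"
  by (rule equivp_quadratic_ideal)

instantiation clifford :: (real_inner) "{ring, monoid_mult}"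
begin

lift_definition zero_clifford :: "'a clifford" is 0 .
lift_definition one_clifford :: "'a clifford" is 1 .
lift_definition plus_clifford :: "'a clifford \<Rightarrow> 'a clifford \<Rightarrow> 'a clifford" is plus
  by (rule quadratic_ideal_cong_add)
lift_definition minus_clifford :: "'a clifford \<Rightarrow> 'a clifford \<Rightarrow> 'a clifford" is minus
  by (rule quadratic_ideal_cong_diff)
lift_definition uminus_clifford :: "'a clifford \<Rightarrow> 'a clifford" is uminus
  by (rule quadratic_ideal_cong_uminus)
lift_definition times_clifford :: "'a clifford \<Rightarrow> 'a clifford \<Rightarrow> 'a clifford" is times
  by (rule quadratic_ideal_cong_mult)

instance
  by standard (transfer, simp add: quadratic_ideal.zero algebra_simps)+

end

lift_definition cliff_scale :: "complex \<Rightarrow> 'a::real_inner clifford \<Rightarrow> 'a clifford"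
  is "\<lambda>c a. free_const c * a"
  by (metis quadratic_ideal.mult_left right_diff_distrib)

lift_definition cliff_vec :: "'a::real_inner complexification \<Rightarrow> 'a clifford" is free_gen .

lemma free_const_simps:
  "free_const (c + d) = free_const c + free_const d"
  "free_const (c * d) = free_const c * free_const d"
  "free_const 1 = 1"
  by (simp_all add: free_const_def single_add mult_single)

lemma vector_space_ext_scale:
  "vector_space (ext_scale :: complex \<Rightarrow> 'a::real_vector exterior \<Rightarrow> 'a exterior)"
  by unfold_locales
    (transfer, simp add: quadratic_ideal.zero free_const_simps algebra_simps)+

lemma vector_space_cliff_scale:
  "vector_space (cliff_scale :: complex \<Rightarrow> 'a::real_inner clifford \<Rightarrow> 'a clifford)"
  by unfold_locales
    (transfer, simp add: quadratic_ideal.zero free_const_simps algebra_simps)+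

lemma linear_ext_vec: "Vector_Spaces.linear cscale ext_scale ext_vec"
proof -
  interpret vector_space_pair cscale "ext_scale :: complex \<Rightarrow> 'a exterior \<Rightarrow> 'a exterior"
    by (simp add: vector_space_pair_def vector_space_cscale vector_space_ext_scale)
  show ?thesis
    by unfold_locales
      (transfer, simp add: quadratic_ideal.gen_add quadratic_ideal.gen_scale
        flip: diff_diff_eq)+
qed

lemma linear_cliff_vec: "Vector_Spaces.linear cscale cliff_scale cliff_vec"
proof -
  interpret vector_space_pair cscale "cliff_scale :: complex \<Rightarrow> 'a clifford \<Rightarrow> 'a clifford"
    by (simp add: vector_space_pair_def vector_space_cscale vector_space_cliff_scale)
  show ?thesis
    by unfold_locales
      (transfer, simp add: quadratic_ideal.gen_add quadratic_ideal.gen_scale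
        flip: diff_diff_eq)+
qed

lemma ext_vec_square: "ext_vec z * ext_vec z = 0"
  using quadratic_ideal.gen_square[of z "\<lambda>_. 0"]
  by transfer (simp add: free_const_def)

lemma cliff_vec_square: "cliff_vec z * cliff_vec z = cliff_scale (cbilin z z) 1"
  by transfer
    (use quadratic_ideal.gen_square[where q = "\<lambda>z. cbilin z z"] in simp)


section \<open>The trace\<close>

definition cliff_parity :: "'a::real_inner clifford \<Rightarrow> 'a clifford" where
  "cliff_parity =
     (THE \<Gamma>. Vector_Spaces.linear cliff_scale cliff_scale \<Gamma> \<and> bij \<Gamma> \<and>
        \<Gamma> 1 = 1 \<and> (\<forall>a b. \<Gamma> (a * b) = \<Gamma> a * \<Gamma> b) \<and>
        (\<forall>z. \<Gamma> (cliff_vec z) = cliff_vec (- z)))"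

definition cliff_trace :: "'a::real_inner clifford \<Rightarrow> complex" where
  "cliff_trace =
     (THE \<tau>. Vector_Spaces.linear cliff_scale (*) \<tau> \<and>
        \<tau> 1 = 1 \<and> \<tau> \<circ> cliff_parity = \<tau> \<and> (\<forall>a b. \<tau> (a * b) = \<tau> (b * a)))"


section \<open>Orthogonal complex structures\<close>

definition orthogonal_complex_structure :: "('a::real_inner \<Rightarrow> 'a) \<Rightarrow> bool" where
  "orthogonal_complex_structure J \<longleftrightarrow>
     linear J \<and> (\<forall>x y. J x \<bullet> J y = x \<bullet> y) \<and> (\<forall>x. J (J x) = - x)"

definition scale_J :: "('a::real_inner \<Rightarrow> 'a) \<Rightarrow> complex \<Rightarrow> 'a \<Rightarrow> 'a" where
  "scale_J J c x = Re c *\<^sub>R x + Im c *\<^sub>R J x"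

definition inner_J :: "('a::real_inner \<Rightarrow> 'a) \<Rightarrow> 'a \<Rightarrow> 'a \<Rightarrow> complex" where
  "inner_J J x y = Complex (x \<bullet> y) (J x \<bullet> y)"

definition dim_J :: "('a::real_inner \<Rightarrow> 'a) \<Rightarrow> nat" where
  "dim_J J = vector_space.dim (scale_J J) UNIV"

definition unitary_basis :: "('a::real_inner \<Rightarrow> 'a) \<Rightarrow> (nat \<Rightarrow> 'a) \<Rightarrow> bool" where
  "unitary_basis J v \<longleftrightarrow>
     (\<forall>m\<in>{1..dim_J J}. \<forall>n\<in>{1..dim_J J}. inner_J J (v m) (v n) = (if m = n then 1 else 0)) \<and>
     module.span (scale_J J) (v ` {1..dim_J J}) = UNIV"

definition eigenspace_plus :: "('a::real_inner \<Rightarrow> 'a) \<Rightarrow> 'a complexification set" where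
  "eigenspace_plus J = {w. map_prod J J w = cscale \<i> w}"

definition eigenspace_minus :: "('a::real_inner \<Rightarrow> 'a) \<Rightarrow> 'a complexification set" where
  "eigenspace_minus J = {w. map_prod J J w = cscale (- \<i>) w}"

definition gamma_plus :: "('a::real_inner \<Rightarrow> 'a) \<Rightarrow> 'a \<Rightarrow> 'a complexification" where
  "gamma_plus J v = (v /\<^sub>R sqrt 2, - J v /\<^sub>R sqrt 2)"

definition gamma_minus :: "('a::real_inner \<Rightarrow> 'a) \<Rightarrow> 'a \<Rightarrow> 'a complexification" where
  "gamma_minus J v = (v /\<^sub>R sqrt 2, J v /\<^sub>R sqrt 2)"

lemma gamma_plus_in_eigenspace:
  "orthogonal_complex_structure J \<Longrightarrow> gamma_plus J v \<in> eigenspace_plus J"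
  by (simp add: orthogonal_complex_structure_def gamma_plus_def eigenspace_plus_def cscale_def
      linear_scale linear_neg)

lemma gamma_minus_in_eigenspace:
  "orthogonal_complex_structure J \<Longrightarrow> gamma_minus J v \<in> eigenspace_minus J"
  by (simp add: orthogonal_complex_structure_def gamma_minus_def eigenspace_minus_def cscale_def
      linear_scale linear_neg)


section \<open>The Berezin expectation\<close>

definition ext_power :: "nat \<Rightarrow> 'a::real_vector exterior set" where
  "ext_power k = module.span ext_scale {prod_list (map ext_vec zs) |zs. length zs = k}"

definition ext_component :: "nat \<Rightarrow> 'a::real_vector exterior \<Rightarrow> 'a exterior" where
  "ext_component k \<zeta> =
     (THE \<alpha>. \<alpha> \<in> ext_power k \<and>
        \<zeta> - \<alpha> \<in> module.span ext_scale (\<Union>j\<in>- {k}. ext_power j))"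

text \<open>
  The exponential series with its vanishing terms dropped; it is meant for nilpotent
  arguments, for which the remaining sum is finite.
\<close>

definition ext_exp :: "'a::real_vector exterior \<Rightarrow> 'a exterior" where
  "ext_exp a = (\<Sum>k | a ^ k \<noteq> 0. ext_scale (1 / fact k) (a ^ k))"

text \<open>The element described is the same for all unitary bases.\<close>

definition berezin_gamma :: "('a::real_inner \<Rightarrow> 'a) \<Rightarrow> 'a exterior" where
  "berezin_gamma J =
     (THE g. \<exists>v. unitary_basis J v \<and>
        g = (\<Sum>m = 1..dim_J J. ext_vec (gamma_plus J (v m)) * ext_vec (gamma_minus J (v m))))"

definition berezin_omega :: "('a::real_inner \<Rightarrow> 'a) \<Rightarrow> 'a exterior" where
  "berezin_omega J =
     ext_scale (1 / fact (dim_J J)) ((- berezin_gamma J) ^ dim_J J)"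

definition berezin_expectation :: "('a::real_inner \<Rightarrow> 'a) \<Rightarrow> 'a exterior \<Rightarrow> complex" where
  "berezin_expectation J \<zeta> =
     (THE c. ext_component (2 * dim_J J) (\<zeta> * ext_exp (- berezin_gamma J))
        = ext_scale c (berezin_omega J))"


section \<open>Antinormal ordering\<close>

inductive_set ext_subalgebra ::
  "'a::real_vector complexification set \<Rightarrow> 'a exterior set"
  for W :: "'a complexification set" where
  one: "1 \<in> ext_subalgebra W"
| vec: "w \<in> W \<Longrightarrow> ext_vec w \<in> ext_subalgebra W"
| scale: "\<alpha> \<in> ext_subalgebra W \<Longrightarrow> ext_scale c \<alpha> \<in> ext_subalgebra W"
| add: "\<alpha> \<in> ext_subalgebra W \<Longrightarrow> \<beta> \<in> ext_subalgebra W \<Longrightarrow> \<alpha> + \<beta> \<in> ext_subalgebra W"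
| mult: "\<alpha> \<in> ext_subalgebra W \<Longrightarrow> \<beta> \<in> ext_subalgebra W \<Longrightarrow> \<alpha> * \<beta> \<in> ext_subalgebra W"

text \<open>
  For a totally isotropic subspace \<open>W\<close>, the canonical embedding of the exterior algebra of
  \<open>W\<close> into the Clifford algebra: the unital algebra homomorphism that fixes \<open>W\<close>.
\<close>

definition isotropic_embedding ::
  "'a::real_inner complexification set \<Rightarrow> 'a exterior \<Rightarrow> 'a clifford" where
  "isotropic_embedding W =
     (THE \<kappa>. \<kappa> \<in> extensional (ext_subalgebra W) \<and>
        \<kappa> 1 = 1 \<and> (\<forall>w\<in>W. \<kappa> (ext_vec w) = cliff_vec w) \<and>
        (\<forall>c. \<forall>\<alpha>\<in>ext_subalgebra W. \<kappa> (ext_scale c \<alpha>) = cliff_scale c (\<kappa> \<alpha>)) \<and>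
        (\<forall>\<alpha>\<in>ext_subalgebra W. \<forall>\<beta>\<in>ext_subalgebra W. \<kappa> (\<alpha> + \<beta>) = \<kappa> \<alpha> + \<kappa> \<beta>) \<and>
        (\<forall>\<alpha>\<in>ext_subalgebra W. \<forall>\<beta>\<in>ext_subalgebra W. \<kappa> (\<alpha> * \<beta>) = \<kappa> \<alpha> * \<kappa> \<beta>))"

definition antinormal :: "('a::real_inner \<Rightarrow> 'a) \<Rightarrow> 'a exterior \<Rightarrow> 'a clifford" where
  "antinormal J =
     (THE \<nu>. Vector_Spaces.linear ext_scale cliff_scale \<nu> \<and>
        (\<forall>\<alpha>\<in>ext_subalgebra (eigenspace_minus J). \<forall>\<beta>\<in>ext_subalgebra (eigenspace_plus J).
           \<nu> (\<alpha> * \<beta>) =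
             isotropic_embedding (eigenspace_minus J) \<alpha> *
             isotropic_embedding (eigenspace_plus J) \<beta>))"

end

theory Submission
  imports Defs "HOL-Library.Function_Algebras"
begin

text \<open>
  Both functionals satisfy the same first-order recursion, and the recursion has only one solution
  with value \<open>1\<close> at \<open>1\<close>. The recursion is phrased with the contraction \<open>\<iota>\<^sub>x\<close>, the antiderivation
  with \<open>\<iota>\<^sub>x(y) = (x|y)\<close>, which exists on the exterior algebra and on the Clifford algebra alike.
  Write \<open>z = z\<^sup>- + z\<^sup>+\<close> for the decomposition into the \<open>\<mp>i\<close> eigenspaces of \<open>J\<close> and
  \<open>z' = z\<^sup>- - z\<^sup>+\<close>. The claim is that \<open>F(z \<and> \<zeta>) = F(\<iota>\<^bsub>z'\<^esub> \<zeta>)\<close> for \<open>F = \<tau> \<circ> \<nu>\<close> and for \<open>F = \<bbbE>\<close>.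
  Contraction shortens a product of vectors, so this and \<open>F(1)\<close> determine a linear \<open>F\<close>
  (\<open>contraction_recursion_unique\<close>).

  For \<open>\<tau> \<circ> \<nu>\<close>: in the Clifford algebra \<open>2 \<iota>\<^sub>x a = x a - \<Gamma>(a) x\<close>, so a trace that is invariant
  under \<open>\<Gamma>\<close> satisfies \<open>\<tau>(x a) = \<tau>(\<iota>\<^sub>x a)\<close> (\<open>trace_vec_mult\<close>). The map \<open>\<nu>\<close> is evaluation at \<open>1\<close> of
  the representation of the exterior algebra on the Clifford algebra in which \<open>z\<close> acts by
  \<open>a \<mapsto> z a - 2 \<iota>\<^bsub>z\<^sup>+\<^esub> a\<close>: the operators square to zero because \<open>2 (z\<^sup>+|z) = (z|z)\<close>. This \<open>\<nu>\<close>
  commutes with contractions, so \<open>\<tau>(\<nu>(z \<and> \<zeta>)) = \<tau>(\<iota>\<^sub>z \<nu> \<zeta>) - 2 \<tau>(\<iota>\<^bsub>z\<^sup>+\<^esub> \<nu> \<zeta>) = \<tau>(\<nu>(\<iota>\<^bsub>z'\<^esub> \<zeta>))\<close>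
  (\<open>trace_nu_vec_mult\<close>).

  For \<open>\<bbbE>\<close>: integration by parts. A contraction has no component in the top degree \<open>2M\<close>, since degree
  \<open>2M + 1\<close> vanishes. As \<open>\<iota>\<^bsub>z'\<^esub> \<gamma> = z\<close>, one has \<open>\<iota>\<^bsub>z'\<^esub> e\<^sup>-\<^sup>\<gamma> = - z \<and> e\<^sup>-\<^sup>\<gamma>\<close>, and the top component of
  \<open>\<iota>\<^bsub>z'\<^esub>(\<zeta> \<and> e\<^sup>-\<^sup>\<gamma>) = \<iota>\<^bsub>z'\<^esub> \<zeta> \<and> e\<^sup>-\<^sup>\<gamma> - z \<and> \<zeta> \<and> e\<^sup>-\<^sup>\<gamma>\<close> is zero (\<open>graded_part_vec_mult_exp\<close>).
  Hence the top component of \<open>\<zeta> \<and> e\<^sup>-\<^sup>\<gamma>\<close> is \<open>\<tau>(\<nu>(\<zeta>)) \<omega>\<close>. That \<open>\<omega>\<close> is not zero, so that it determines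
  its coefficient, follows from the same identity, because \<open>\<tau> \<circ> \<nu>\<close> takes the value \<open>1\<close> on a product
  of \<open>2M\<close> vectors.

  All the maps involved (parity, contraction, grading, the trace, \<open>\<nu>\<close>) come from one universal
  property, \<open>lift\<close>: prescribing operators \<open>f z\<close>, linear in \<open>z\<close>, with \<open>f z \<circ> f z = q z\<close> on a vector
  space makes it a module over the algebra. This replaces computations in a basis of the
  algebras. A unitary basis of \<open>V\<close> serves to expand \<open>\<gamma>\<close> and \<open>\<omega>\<close> and to see that the degrees above
  \<open>2M\<close> vanish.
\<close>

section \<open>Algebras presented by a quadratic relation\<close>

lemma free_algebra_induct [case_names zero add monomial]:
  fixes a :: "'v free_algebra"
  assumes "P 0" and "\<And>a b. P a \<Longrightarrow> P b \<Longrightarrow> P (a + b)"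
    and "\<And>u c. P (Poly_Mapping.single u c)"
  shows "P a"
proof (induction a rule: update_induct)
  case const
  show ?case by (rule assms(1))
next
  case (update f a b)
  have "Poly_Mapping.update a b f = Poly_Mapping.single a b + f"
    using update
    by (intro poly_mapping_eqI)
       (auto simp: lookup_update lookup_add lookup_single when_def in_keys_iff)
  then show ?case using assms update by simp
qed

definition free_action ::
  "(complex \<Rightarrow> 'w \<Rightarrow> 'w::ab_group_add) \<Rightarrow> ('v \<Rightarrow> 'w \<Rightarrow> 'w) \<Rightarrow> 'v free_algebra \<Rightarrow> 'w \<Rightarrow> 'w" where
  "free_action s f a x =
     (\<Sum>u\<in>Poly_Mapping.keys a. s (Poly_Mapping.lookup a u) (foldr f (letters u) x))"

text \<open>
  A module over the algebra generated by the vectors \<open>z\<close> subject to \<open>z\<^sup>2 = q z\<close>, given by the action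
  \<open>f\<close> of the generators alone.
\<close>

locale quadratic_module = vector_space s
  for s :: "complex \<Rightarrow> 'w::ab_group_add \<Rightarrow> 'w" +
  fixes q :: "'a::real_vector complexification \<Rightarrow> complex"
    and f :: "'a complexification \<Rightarrow> 'w \<Rightarrow> 'w"
  assumes f_add: "f z (x + y) = f z x + f z y"
    and f_scale: "f z (s c x) = s c (f z x)"
    and add_f: "f (w + z) x = f w x + f z x"
    and scale_f: "f (cscale c z) x = s c (f z x)"
    and f_square: "f z (f z x) = s (q z) x"
begin

abbreviation "act \<equiv> free_action s f"

lemma foldr_add: "foldr f zs (x + y) = foldr f zs x + foldr f zs y"
  by (induction zs) (simp_all add: f_add)

lemma foldr_scale: "foldr f zs (s c x) = s c (foldr f zs x)"
  by (induction zs) (simp_all add: f_scale)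

lemma act_superset:
  assumes "finite A" "Poly_Mapping.keys a \<subseteq> A"
  shows "act a x = (\<Sum>u\<in>A. s (Poly_Mapping.lookup a u) (foldr f (letters u) x))"
  unfolding free_action_def using assms
  by (intro sum.mono_neutral_left) (auto simp: in_keys_iff)

lemma act_zero_left: "act 0 x = 0"
  by (simp add: free_action_def)

lemma act_add_left: "act (a + b) x = act a x + act b x"
proof -
  let ?A = "Poly_Mapping.keys a \<union> Poly_Mapping.keys b"
  have "Poly_Mapping.keys (a + b) \<subseteq> ?A" by (rule keys_add)
  then show ?thesis
    by (simp add: act_superset[where A = ?A] lookup_add scale_left_distrib sum.distrib)
qed

lemma act_single: "act (Poly_Mapping.single u c) x = s c (foldr f (letters u) x)"
  by (subst act_superset[of "{u}"]) auto

lemma act_add: "act a (x + y) = act a x + act a y"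
  by (simp add: free_action_def foldr_add scale_right_distrib sum.distrib)

lemma act_zero: "act a 0 = 0"
  using act_add[of a 0 0] by simp

lemma act_mult: "act (a * b) x = act a (act b x)"
proof (induction a rule: free_algebra_induct)
  case (monomial u c)
  show ?case
  proof (induction b rule: free_algebra_induct)
    case (monomial v d)
    show ?case
      by (simp add: mult_single act_single plus_word_def foldr_scale)
  qed (simp_all add: act_zero_left act_zero act_add_left act_add distrib_left)
qed (simp_all add: act_zero_left act_add_left distrib_right)

lemma act_const: "act (free_const c) x = s c x"
  by (simp add: free_const_def act_single zero_word_def)

lemma act_gen: "act (free_gen z) x = f z x"
  by (simp add: free_gen_def act_single)

lemma act_uminus_left: "act (- a) x = - act a x"
  using act_add_left[of a "- a" x] by (simp add: act_zero_left minus_unique)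

lemma act_diff_left: "act (a - b) x = act a x - act b x"
  using act_add_left[of a "- b" x] by (simp add: act_uminus_left)

text \<open>
  The induction has to be carried out for all \<open>x\<close> at once, because the ideal is closed under right
  multiplication, which replaces \<open>x\<close> by another vector.
\<close>

lemma act_ideal: "a \<in> quadratic_ideal q \<Longrightarrow> act a x = 0"
  by (induction arbitrary: x rule: quadratic_ideal.induct)
    (simp_all add: act_diff_left act_add_left act_mult act_const act_gen act_zero act_zero_left
      add_f scale_f f_square)

end

text \<open>
  The quotient of the free algebra by the quadratic ideal of \<open>q\<close>, described through its projection
  \<open>proj\<close>, so that the exterior algebra (\<open>q = 0\<close>) and the Clifford algebra are treated together.
\<close>

locale quadratic_algebra = vector_space scale
  for scale :: "complex \<Rightarrow> 'c::{ring,monoid_mult} \<Rightarrow> 'c" +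
  fixes q :: "'a::real_inner complexification \<Rightarrow> complex"
    and vec :: "'a complexification \<Rightarrow> 'c"
    and proj :: "'a complexification free_algebra \<Rightarrow> 'c"
  assumes proj_surj: "surj proj"
    and proj_eq_iff: "proj a = proj b \<longleftrightarrow> a - b \<in> quadratic_ideal q"
    and proj_add: "proj (a + b) = proj a + proj b"
    and proj_mult: "proj (a * b) = proj a * proj b"
    and proj_one: "proj 1 = 1"
    and proj_const_mult: "proj (free_const c * a) = scale c (proj a)"
    and proj_gen: "proj (free_gen z) = vec z"
begin

text \<open>
  The universal property in the form used throughout: the algebra is the free quadratic module on
  one generator. A map out of the algebra is obtained by letting the vectors act on the intended
  target and evaluating at \<open>x\<close>; the only thing to verify is the quadratic relation.
\<close>

lemma lift:
  assumes "quadratic_module s q f"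
  obtains h where "Vector_Spaces.linear scale s h" "h 1 = x" "\<And>z a. h (vec z * a) = f z (h a)"
proof -
  interpret W: quadratic_module s q f by fact
  define h where "h a = W.act (inv proj a) x" for a
  have h_proj: "h (proj a) = W.act a x" for a
  proof -
    have "inv proj (proj a) - a \<in> quadratic_ideal q"
      using proj_eq_iff[of "inv proj (proj a)" a] by (simp add: f_inv_into_f)
    then show ?thesis
      using W.act_ideal[of "inv proj (proj a) - a" x] by (simp add: h_def W.act_diff_left)
  qed
  have ex: "\<exists>a'. a = proj a'" for a using proj_surj by (metis surjD)
  have add: "h (a + b) = h a + h b" for a b
  proof -
    obtain a' b' where "a = proj a'" "b = proj b'" using ex by blast
    then show ?thesis by (simp add: h_proj W.act_add_left flip: proj_add)
  qed
  have scale: "h (scale c a) = s c (h a)" for c a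
  proof -
    obtain a' where "a = proj a'" using ex by blast
    then show ?thesis by (simp add: h_proj W.act_mult W.act_const flip: proj_const_mult)
  qed
  have mult: "h (vec z * a) = f z (h a)" for z a
  proof -
    obtain a' where "a = proj a'" using ex by blast
    then show ?thesis by (simp add: h_proj W.act_mult W.act_gen flip: proj_gen proj_mult)
  qed
  have "h 1 = x"
    using h_proj[of 1] W.act_const[of 1 x] by (simp add: proj_one free_const_simps(3))
  moreover have "Vector_Spaces.linear scale s h"
    by (simp add: Vector_Spaces.linear_iff add scale vector_space_axioms W.vector_space_axioms)
  ultimately show thesis using mult that by blast
qed

lemma induct [case_names one add scale mult]:
  assumes one: "P 1" and add: "\<And>a b. P a \<Longrightarrow> P b \<Longrightarrow> P (a + b)"
    and scale: "\<And>c a. P a \<Longrightarrow> P (scale c a)" and mult: "\<And>z a. P a \<Longrightarrow> P (vec z * a)"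
  shows "P a"
proof -
  have words: "P (proj (Poly_Mapping.single (Word zs) 1))" for zs
  proof (induction zs)
    case Nil
    then show ?case
      using one proj_one by (simp add: single_one flip: zero_word_def)
  next
    case (Cons z zs)
    have "Poly_Mapping.single (Word (z # zs)) 1 =
        free_gen z * (Poly_Mapping.single (Word zs) 1 :: 'a complexification free_algebra)"
      by (simp add: free_gen_def mult_single plus_word_def)
    then show ?case using mult Cons by (simp add: proj_mult proj_gen)
  qed
  have "P (proj a)" for a
  proof (induction a rule: free_algebra_induct)
    case zero
    have "proj 0 = scale 0 1" using proj_add[of 0 0] by simp
    then show ?case using scale one by metis
  next
    case (add a b)
    then show ?case by (simp add: proj_add assms(2))
  next
    case (monomial u c)
    have "Poly_Mapping.single u c = free_const c * Poly_Mapping.single (Word (letters u)) 1"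
      by (simp add: free_const_def mult_single)
    then show ?case
      using scale[OF words[of "letters u"]] by (simp add: proj_const_mult)
  qed
  then show ?thesis using proj_surj by (metis surjD)
qed

lemma scale_mult_left: "scale c a * b = scale c (a * b)"
proof -
  obtain a' b' where "a = proj a'" "b = proj b'" using proj_surj by (metis surjD)
  then show ?thesis by (simp add: mult.assoc flip: proj_const_mult proj_mult)
qed

lemma free_const_commute: "free_const c * a = a * free_const c"
  for a :: "'v free_algebra"
  by (induction a rule: free_algebra_induct)
     (simp_all add: free_const_def mult_single distrib_left distrib_right mult.commute)

lemma scale_mult_right: "a * scale c b = scale c (a * b)"
proof -
  obtain a' b' where "a = proj a'" "b = proj b'" using proj_surj by (metis surjD)
  moreover have "a' * (free_const c * b') = free_const c * (a' * b')"
    by (metis free_const_commute mult.assoc)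
  ultimately show ?thesis by (metis proj_const_mult proj_mult)
qed

lemma vec_add: "vec (w + z) = vec w + vec z"
proof -
  have "free_gen (w + z) - (free_gen w + free_gen z) \<in> quadratic_ideal q"
    using quadratic_ideal.gen_add by (simp add: diff_diff_eq)
  then show ?thesis by (simp add: proj_add proj_gen flip: proj_eq_iff)
qed

lemma vec_scale: "vec (cscale c z) = scale c (vec z)"
  using proj_eq_iff[THEN iffD2, OF quadratic_ideal.gen_scale[of c z q]]
  by (simp add: proj_const_mult proj_gen)

lemma vec_square: "vec z * vec z = scale (q z) 1"
  using proj_eq_iff[THEN iffD2, OF quadratic_ideal.gen_square[of z q]]
    proj_const_mult[of "q z" 1]
  by (simp add: proj_mult proj_gen proj_one)

end

section \<open>Parity, contraction and degree\<close>

lemma cbilin_add_left: "cbilin (w + x) z = cbilin w z + cbilin x z"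
  by (simp add: cbilin_def complex_eq_iff algebra_simps)

lemma cbilin_add_right: "cbilin z (w + x) = cbilin z w + cbilin z x"
  by (simp add: cbilin_def complex_eq_iff algebra_simps)

lemma cbilin_cscale_left: "cbilin (cscale c w) z = c * cbilin w z"
  by (simp add: cbilin_def cscale_def complex_eq_iff algebra_simps)

lemma cbilin_cscale_right: "cbilin z (cscale c w) = c * cbilin z w"
  by (simp add: cbilin_def cscale_def complex_eq_iff algebra_simps)

lemma cbilin_commute: "cbilin w z = cbilin z w"
  by (simp add: cbilin_def complex_eq_iff inner_commute)

context quadratic_algebra
begin

lemma vec_uminus: "vec (- z) = - vec z"
  using vec_scale[of "- 1" z] by (simp add: cscale_def uminus_prod_def)

lemma vec_polarization:
  "vec x * vec z + vec z * vec x = scale (q (x + z) - q x - q z) 1"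
  using vec_square[of "x + z"]
  by (simp add: vec_add vec_square distrib_left distrib_right scale_left_diff_distrib algebra_simps)

definition parity :: "'c \<Rightarrow> 'c" where
  "parity = (SOME G. Vector_Spaces.linear scale scale G \<and> G 1 = 1 \<and>
     (\<forall>z a. G (vec z * a) = - (vec z * G a)))"

text \<open>
  The algebra acts on itself by \<open>a \<mapsto> - z a\<close>, which squares to \<open>q z\<close> as well.
\<close>

lemma parity_spec:
  "Vector_Spaces.linear scale scale parity \<and> parity 1 = 1 \<and>
     (\<forall>z a. parity (vec z * a) = - (vec z * parity a))"
proof -
  have "quadratic_module scale q (\<lambda>z a. - (vec z * a))"
    by unfold_locales
       (simp_all add: vec_add vec_scale distrib_left distrib_right scale_mult_left scale_mult_right
          vec_square flip: mult.assoc)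
  from lift[OF this, of 1] obtain G where
    "Vector_Spaces.linear scale scale G" "G 1 = 1" "\<And>z a. G (vec z * a) = - (vec z * G a)"
    by blast
  then have "\<exists>G. Vector_Spaces.linear scale scale G \<and> G 1 = 1 \<and>
      (\<forall>z a. G (vec z * a) = - (vec z * G a))"
    by blast
  then show ?thesis unfolding parity_def by (rule someI_ex)
qed

lemma module_hom_parity: "module_hom scale scale parity"
  using parity_spec by (simp add: Vector_Spaces.linear_def)

lemmas parity_linear [simp] =
  module_hom.add[OF module_hom_parity] module_hom.scale[OF module_hom_parity]
  module_hom.zero[OF module_hom_parity] module_hom.neg[OF module_hom_parity]
  module_hom.diff[OF module_hom_parity] module_hom.sum[OF module_hom_parity]

lemma parity_one [simp]: "parity 1 = 1"
  and parity_vec_mult [simp]: "parity (vec z * a) = - (vec z * parity a)"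
  using parity_spec by blast+

lemma parity_vec [simp]: "parity (vec z) = - vec z"
  using parity_vec_mult[of z 1] by simp

text \<open>
  The antiderivation \<open>\<iota>\<^sub>x\<close> that extends the linear form \<open>(x|\<bullet>)\<close>. The same form is used for every
  relation \<open>q\<close>, so that contractions in the exterior and the Clifford algebra can be compared.
\<close>

definition contraction :: "'a complexification \<Rightarrow> 'c \<Rightarrow> 'c" where
  "contraction x = (SOME d. Vector_Spaces.linear scale scale d \<and> d 1 = 0 \<and>
     (\<forall>z a. d (vec z * a) = scale (cbilin x z) a - vec z * d a))"

text \<open>
  An antiderivation \<open>d\<close> amounts to the algebra homomorphism from \<open>a\<close> to the lower triangular matrix
  with columns \<open>(a, d a)\<close> and \<open>(0, \<Gamma> a)\<close>; only its first column is recorded, so \<open>z\<close> acts on pairs by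
  \<open>(p, r) \<mapsto> (z p, (x|z) p - z r)\<close>. The cross terms cancel in the square.
\<close>

lemma contraction_spec:
  "Vector_Spaces.linear scale scale (contraction x) \<and> contraction x 1 = 0 \<and>
     (\<forall>z a. contraction x (vec z * a) = scale (cbilin x z) a - vec z * contraction x a)"
proof -
  define s where "s c p = (scale c (fst p), scale c (snd p))" for c and p :: "'c \<times> 'c"
  define f where "f z p = (vec z * fst p, scale (cbilin x z) (fst p) - vec z * snd p)"
    for z and p :: "'c \<times> 'c"
  have "quadratic_module s q f"
    by unfold_locales
      (simp_all add: s_def f_def prod_eq_iff vec_add vec_scale distrib_left distrib_right
         scale_mult_left scale_mult_right vec_square cbilin_add_right cbilin_cscale_right
         scale_left_distrib scale_right_distrib scale_right_diff_distrib right_diff_distrib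
         mult.commute algebra_simps
         flip: mult.assoc)
  from lift[OF this, of "(1, 0)"] obtain h where h:
    "Vector_Spaces.linear scale s h" "h 1 = (1, 0)" "\<And>z a. h (vec z * a) = f z (h a)"
    by blast
  have h_add: "h (a + b) = h a + h b" and h_scale: "h (scale c a) = s c (h a)" for a b c
    using h(1) by (auto simp: Vector_Spaces.linear_iff)
  have fst_h: "fst (h a) = a" for a
    by (induction a rule: induct) (simp_all add: h h_add h_scale s_def f_def)
  have "Vector_Spaces.linear scale scale (\<lambda>a. snd (h a))"
    by (simp add: Vector_Spaces.linear_iff vector_space_axioms h_add h_scale s_def)
  moreover have "snd (h (vec z * a)) = scale (cbilin x z) a - vec z * snd (h a)" for z a
    by (simp add: h f_def fst_h)
  moreover have "snd (h 1) = 0" by (simp add: h)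
  ultimately have "\<exists>d. Vector_Spaces.linear scale scale d \<and> d 1 = 0 \<and>
      (\<forall>z a. d (vec z * a) = scale (cbilin x z) a - vec z * d a)"
    by blast
  then show ?thesis unfolding contraction_def by (rule someI_ex)
qed

lemma module_hom_contraction: "module_hom scale scale (contraction x)"
  using contraction_spec by (simp add: Vector_Spaces.linear_def)

lemmas contraction_linear [simp] =
  module_hom.add[OF module_hom_contraction] module_hom.scale[OF module_hom_contraction]
  module_hom.zero[OF module_hom_contraction] module_hom.neg[OF module_hom_contraction]
  module_hom.diff[OF module_hom_contraction] module_hom.sum[OF module_hom_contraction]

lemma contraction_one [simp]: "contraction x 1 = 0"
  and contraction_vec_mult [simp]:
    "contraction x (vec z * a) = scale (cbilin x z) a - vec z * contraction x a"
  using contraction_spec by blast+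

lemma contraction_vec [simp]: "contraction x (vec z) = scale (cbilin x z) 1"
  using contraction_vec_mult[of x z 1] by simp

lemma parity_mult: "parity (a * b) = parity a * parity b"
  by (induction a rule: induct)
    (simp_all add: distrib_right scale_mult_left mult.assoc)

lemma parity_parity [simp]: "parity (parity a) = a"
  by (induction a rule: induct) simp_all

lemma contraction_mult: "contraction x (a * b) = contraction x a * b + parity a * contraction x b"
  by (induction a rule: induct)
    (simp_all add: distrib_right distrib_left left_diff_distrib scale_mult_left mult.assoc
      scale_right_distrib)

lemma contraction_parity: "contraction x (parity a) = - parity (contraction x a)"
  by (induction a rule: induct) simp_all

lemma contraction_anticommute: "contraction x (contraction y a) = - contraction y (contraction x a)"
  by (induction a rule: induct) (simp_all add: algebra_simps)

lemma contraction_contraction [simp]: "contraction x (contraction x a) = 0"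
  by (induction a rule: induct) simp_all

lemma contraction_add_left: "contraction (x + y) a = contraction x a + contraction y a"
  by (induction a rule: induct)
    (simp_all add: cbilin_add_left algebra_simps scale_left_distrib)

lemma contraction_cscale_left: "contraction (cscale c x) a = scale c (contraction x a)"
  by (induction a rule: induct)
    (simp_all add: cbilin_cscale_left scale_right_distrib scale_right_diff_distrib
      scale_mult_right mult.commute)

text \<open>
  In the Clifford algebra these subspaces may overlap; they are used there only to measure the length of
  products. In the exterior algebra they are the exterior powers.
\<close>

definition homogeneous :: "nat \<Rightarrow> 'c set" where
  "homogeneous n = span {prod_list (map vec zs) |zs. length zs = n}"

lemma word_in_homogeneous: "prod_list (map vec zs) \<in> homogeneous (length zs)"
  unfolding homogeneous_def by (intro span_base) blast

lemma homogeneous_induct [consumes 1, case_names zero step]: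
  assumes "a \<in> homogeneous n" "P 0"
    "\<And>c zs b. length zs = n \<Longrightarrow> P b \<Longrightarrow> P (scale c (prod_list (map vec zs)) + b)"
  shows "P a"
  using assms(1) unfolding homogeneous_def
  by (induction rule: span_induct_alt) (use assms in auto)

lemma subspace_homogeneous: "subspace (homogeneous n)"
  by (simp add: homogeneous_def)

lemmas homogeneous_closed =
  subspace_0[OF subspace_homogeneous] subspace_add[OF subspace_homogeneous]
  subspace_diff[OF subspace_homogeneous] subspace_scale[OF subspace_homogeneous]
  subspace_neg[OF subspace_homogeneous] subspace_sum[OF subspace_homogeneous]

lemma homogeneous_mult:
  assumes "a \<in> homogeneous m" "b \<in> homogeneous n"
  shows "a * b \<in> homogeneous (m + n)"
  using assms(1)
proof (induction rule: homogeneous_induct)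
  case (step c zs a')
  have "prod_list (map vec zs) * b \<in> homogeneous (m + n)"
    using assms(2)
  proof (induction rule: homogeneous_induct)
    case (step d ws b')
    have "prod_list (map vec zs) * prod_list (map vec ws) \<in> homogeneous (m + n)"
      using word_in_homogeneous[of "zs @ ws"] step \<open>length zs = m\<close> by simp
    then show ?case
      using step by (simp add: distrib_left scale_mult_right homogeneous_closed)
  qed (simp add: homogeneous_closed)
  then show ?case
    using step by (simp add: distrib_right scale_mult_left homogeneous_closed)
qed (simp add: homogeneous_closed)

lemma vec_in_homogeneous: "vec z \<in> homogeneous 1"
  using word_in_homogeneous[of "[z]"] by simp

lemma contraction_word:
  "contraction x (prod_list (map vec zs)) \<in> homogeneous (length zs - 1)"
proof (induction zs)
  case (Cons z zs)
  show ?case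
  proof (cases zs)
    case Nil
    then show ?thesis
      using word_in_homogeneous[of "[]"]
      by (simp add: homogeneous_closed)
  next
    case (Cons y ys)
    then have "vec z * contraction x (prod_list (map vec zs)) \<in> homogeneous (length zs)"
      using homogeneous_mult[OF vec_in_homogeneous[of z] \<open>contraction x (prod_list (map vec zs)) \<in> _\<close>]
      by simp
    then show ?thesis
      using word_in_homogeneous[of zs] by (simp add: homogeneous_closed)
  qed
qed (simp add: homogeneous_closed)

lemma word_induct [case_names zero step]:
  assumes "P 0" and step: "\<And>c zs b. P b \<Longrightarrow> P (scale c (prod_list (map vec zs)) + b)"
  shows "P a"
proof -
  let ?S = "range (\<lambda>zs. prod_list (map vec zs))"
  have words: "prod_list (map vec zs) \<in> span ?S" for zs
    by (intro span_base rangeI)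
  have "a \<in> span ?S"
  proof (induction a rule: induct)
    case one
    then show ?case using words[of "[]"] by simp
  next
    case (mult z a)
    from mult show ?case
    proof (induction rule: span_induct_alt)
      case (step c x y)
      then obtain zs where "x = prod_list (map vec zs)" by auto
      then have "vec z * x \<in> span ?S" using words[of "z # zs"] by simp
      then show ?case using step by (simp add: distrib_left scale_mult_right span_add span_scale)
    qed (simp add: span_zero)
  qed (auto intro: span_add span_scale)
  then show ?thesis
    by (induction rule: span_induct_alt) (use assms in auto)
qed

text \<open>
  The contraction turns a product of \<open>k\<close> vectors into a combination of products of \<open>k - 1\<close> vectors, so
  the recursion reduces every product to \<open>1\<close> or to \<open>0\<close>. The vector \<open>K z\<close> in place of \<open>z\<close> serves to
  cover both the trace (\<open>K z = z\<close>) and the Berezin expectation (\<open>K z = z\<^sup>- - z\<^sup>+\<close>).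
\<close>

lemma contraction_recursion_unique:
  assumes D: "Vector_Spaces.linear scale s D" and one: "D 1 = 0"
    and rec: "\<And>z a. D (vec z * a) = D (contraction (K z) a)"
  shows "D a = 0"
proof -
  have D_add: "D (a + b) = D a + D b" and D_scale: "D (scale c a) = s c (D a)" for a b c
    using D by (auto simp: Vector_Spaces.linear_iff)
  have D_zero: "D 0 = 0" using D_add[of 0 0] by simp
  then have s_zero: "s c 0 = 0" for c using D_scale[of c 0] by simp
  have word: "D (prod_list (map vec zs)) = 0" for zs
  proof (induction zs rule: length_induct)
    case (1 zs)
    show ?case
    proof (cases zs)
      case Nil
      then show ?thesis by (simp add: one)
    next
      case (Cons z ys)
      show ?thesis
      proof (cases "ys = []")
        case True
        then show ?thesis using rec[of z 1] by (simp add: Cons D_zero)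
      next
        case False
        then have "length ys - 1 < length zs" by (simp add: Cons)
        moreover have "D b = 0" if "b \<in> homogeneous (length ys - 1)" for b
          using that
          by (induction rule: homogeneous_induct)
             (use 1 \<open>length ys - 1 < length zs\<close> in \<open>simp_all add: D_zero D_add D_scale s_zero\<close>)
        then show ?thesis using contraction_word by (simp add: Cons rec)
      qed
    qed
  qed
  show ?thesis
    by (induction a rule: word_induct) (simp_all add: D_zero D_add D_scale word s_zero)
qed

end

interpretation ext: quadratic_algebra ext_scale "\<lambda>_. 0" ext_vec
  "abs_exterior :: 'a::real_inner complexification free_algebra \<Rightarrow> 'a exterior"
  unfolding quadratic_algebra_def quadratic_algebra_axioms_def
proof (intro conjI allI)
  show "surj (abs_exterior :: 'a complexification free_algebra \<Rightarrow> 'a exterior)"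
    by (intro surjI[of _ rep_exterior] Quotient3_abs_rep[OF Quotient3_exterior])
qed (simp_all add: vector_space_ext_scale exterior.abs_eq_iff plus_exterior.abs_eq
    times_exterior.abs_eq one_exterior.abs_eq ext_scale.abs_eq ext_vec.abs_eq)

interpretation cliff: quadratic_algebra cliff_scale "\<lambda>z. cbilin z z" cliff_vec
  "abs_clifford :: 'a::real_inner complexification free_algebra \<Rightarrow> 'a clifford"
  unfolding quadratic_algebra_def quadratic_algebra_axioms_def
proof (intro conjI allI)
  show "surj (abs_clifford :: 'a complexification free_algebra \<Rightarrow> 'a clifford)"
    by (intro surjI[of _ rep_clifford] Quotient3_abs_rep[OF Quotient3_clifford])
qed (simp_all add: vector_space_cliff_scale clifford.abs_eq_iff plus_clifford.abs_eq
    times_clifford.abs_eq one_clifford.abs_eq cliff_scale.abs_eq cliff_vec.abs_eq)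

section \<open>The trace on the Clifford algebra\<close>

lemma cliff_parity_eq: "cliff_parity = cliff.parity"
  unfolding cliff_parity_def
proof (rule the_equality)
  have "bij (cliff.parity :: 'a clifford \<Rightarrow> 'a clifford)"
    by (rule o_bij[of cliff.parity]) auto
  then show "Vector_Spaces.linear cliff_scale cliff_scale (cliff.parity :: 'a clifford \<Rightarrow> 'a clifford) \<and>
      bij (cliff.parity :: 'a clifford \<Rightarrow> 'a clifford) \<and>
      cliff.parity (1 :: 'a clifford) = 1 \<and>
      (\<forall>a b :: 'a clifford. cliff.parity (a * b) = cliff.parity a * cliff.parity b) \<and>
      (\<forall>z :: 'a complexification. cliff.parity (cliff_vec z) = cliff_vec (- z))"
    using cliff.parity_spec by (simp add: cliff.parity_mult cliff.vec_uminus)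
next
  fix G :: "'a clifford \<Rightarrow> 'a clifford"
  assume "Vector_Spaces.linear cliff_scale cliff_scale G \<and> bij G \<and> G 1 = 1 \<and>
      (\<forall>a b. G (a * b) = G a * G b) \<and> (\<forall>z. G (cliff_vec z) = cliff_vec (- z))"
  then have G: "G (a + b) = G a + G b" "G (cliff_scale c a) = cliff_scale c (G a)" "G 1 = 1"
    "G (a * b) = G a * G b" "G (cliff_vec z) = - cliff_vec z" for a b c z
    by (auto simp: Vector_Spaces.linear_iff cliff.vec_uminus simp del: split_paired_All)
  have "G a = cliff.parity a" for a
    by (induction a rule: cliff.induct) (simp_all add: G)
  then show "G = cliff.parity" by blast
qed

text \<open>
  The properties by which \<open>cliff_trace\<close> is singled out, with the parity automorphism already
  identified.
\<close>

definition is_trace :: "('a::real_inner clifford \<Rightarrow> complex) \<Rightarrow> bool" where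
  "is_trace \<tau> \<longleftrightarrow> Vector_Spaces.linear cliff_scale (*) \<tau> \<and> \<tau> 1 = 1 \<and>
     \<tau> \<circ> cliff.parity = \<tau> \<and> (\<forall>a b. \<tau> (a * b) = \<tau> (b * a))"

lemma cliff_anticommutator:
  "cliff_vec x * cliff_vec z + cliff_vec z * cliff_vec x = cliff_scale (2 * cbilin x z) 1"
  by (simp add: cliff.vec_polarization cbilin_add_left cbilin_add_right cbilin_commute)

text \<open>
  Contraction is half of a graded commutator: both sides are antiderivations, and on a vector \<open>z\<close> the
  right-hand side is \<open>x z + z x = 2 (x|z)\<close>.
\<close>

lemma cliff_contraction_eq:
  "cliff_scale 2 (cliff.contraction x a) = cliff_vec x * a - cliff.parity a * cliff_vec x"
proof (induction a rule: cliff.induct)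
  case (mult z a)
  have "cliff_scale 2 (cliff.contraction x (cliff_vec z * a)) =
      cliff_scale (2 * cbilin x z) 1 * a - cliff_vec z * cliff_scale 2 (cliff.contraction x a)"
    by (simp add: cliff.scale_mult_left cliff.scale_mult_right cliff.scale_right_diff_distrib)
  also have "\<dots> = cliff_vec x * (cliff_vec z * a) - cliff.parity (cliff_vec z * a) * cliff_vec x"
    unfolding mult cliff_anticommutator[symmetric] by (simp add: algebra_simps)
  finally show ?case .
next
  case (scale c a)
  have "cliff_scale 2 (cliff.contraction x (cliff_scale c a)) =
      cliff_scale c (cliff_scale 2 (cliff.contraction x a))"
    by (simp add: mult.commute)
  then show ?case
    unfolding scale
    by (simp add: cliff.scale_mult_left cliff.scale_mult_right cliff.scale_right_diff_distrib)
qed (simp_all add: cliff.scale_right_distrib cliff.scale_mult_left cliff.scale_mult_right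
    cliff.scale_right_diff_distrib cliff.scale_left_commute algebra_simps)

text \<open>
  By cyclicity \<open>\<tau>(\<Gamma>(a) x) = \<tau>(x \<Gamma>(a)) = - \<tau>(\<Gamma>(x a)) = - \<tau>(x a)\<close>, so the two terms of the graded
  commutator contribute equally.
\<close>

lemma trace_vec_mult:
  assumes "is_trace \<tau>"
  shows "\<tau> (cliff_vec x * a) = \<tau> (cliff.contraction x a)"
proof -
  have \<tau>: "module_hom cliff_scale (*) \<tau>" "\<tau> \<circ> cliff.parity = \<tau>" "\<And>a b. \<tau> (a * b) = \<tau> (b * a)"
    using assms by (auto simp: is_trace_def Vector_Spaces.linear_def)
  have "2 * \<tau> (cliff.contraction x a) = \<tau> (cliff_vec x * a) - \<tau> (cliff.parity a * cliff_vec x)"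
    using module_hom.scale[OF \<tau>(1), of 2 "cliff.contraction x a"]
    by (simp add: cliff_contraction_eq module_hom.diff[OF \<tau>(1)])
  also have "\<tau> (cliff.parity a * cliff_vec x) = - \<tau> (cliff.parity (cliff_vec x * a))"
    by (simp add: \<tau>(3)[of _ "cliff_vec x"] module_hom.neg[OF \<tau>(1)])
  also have "\<tau> (cliff.parity (cliff_vec x * a)) = \<tau> (cliff_vec x * a)"
    using \<tau>(2) by (metis comp_apply)
  finally show ?thesis by simp
qed

text \<open>
  The Fock model: the Clifford algebra acts on the exterior algebra by \<open>z \<mapsto> z \<and> \<bullet> + \<iota>\<^sub>z\<close>, and the trace
  of \<open>a\<close> is the scalar part of \<open>a \<cdot> 1\<close>. Right multiplication by \<open>x\<close> is seen in this model as
  the operator \<open>(x \<and> \<bullet> - \<iota>\<^sub>x) \<circ> \<Gamma>\<close>, which commutes with the action. Left and right multiplication by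
  a vector thus have the same scalar part, whence cyclicity.
\<close>

lemma trace_exists: "\<exists>\<tau> :: 'a::real_inner clifford \<Rightarrow> complex. is_trace \<tau>"
proof -
  have "quadratic_module (*) (\<lambda>_. 0) (\<lambda>(z :: 'a complexification) (c :: complex). 0)"
    by unfold_locales (simp_all add: algebra_simps)
  from ext.lift[OF this, of 1] obtain \<epsilon> :: "'a exterior \<Rightarrow> complex" where
    \<epsilon>: "Vector_Spaces.linear ext_scale (*) \<epsilon>" "\<epsilon> 1 = 1" "\<And>z a. \<epsilon> (ext_vec z * a) = 0"
    by blast
  have \<epsilon>_hom: "module_hom ext_scale (*) \<epsilon>"
    using \<epsilon>(1) by (simp add: Vector_Spaces.linear_def)
  note \<epsilon>_linear = module_hom.add[OF \<epsilon>_hom] module_hom.scale[OF \<epsilon>_hom] module_hom.neg[OF \<epsilon>_hom]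
    module_hom.zero[OF \<epsilon>_hom] module_hom.diff[OF \<epsilon>_hom]
  have \<epsilon>_parity: "\<epsilon> (ext.parity a) = \<epsilon> a" for a
    by (induction a rule: ext.induct) (simp_all add: \<epsilon> \<epsilon>_linear)
  have ext_anti: "ext_vec x * (ext_vec z * a) = - (ext_vec z * (ext_vec x * a))"
    for x z and a :: "'a exterior"
    using ext.vec_polarization[of x z] by (simp add: eq_neg_iff_add_eq_0 flip: mult.assoc distrib_right)
  \<comment> \<open>\<open>L\<close> and \<open>R\<close> represent left and right multiplication by a vector.\<close>
  define L where "L z a = ext_vec z * a + ext.contraction z a" for z and a :: "'a exterior"
  define R where "R z a = ext_vec z * ext.parity a - ext.contraction z (ext.parity a)"
    for z and a :: "'a exterior"
  have "quadratic_module ext_scale (\<lambda>z. cbilin z z) L"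
    by unfold_locales
      (simp_all add: L_def ext.vec_add ext.vec_scale ext.contraction_add_left
        ext.contraction_cscale_left ext.scale_mult_left ext.scale_mult_right
        ext.scale_right_distrib ext_vec_square algebra_simps flip: mult.assoc)
  from cliff.lift[OF this, of 1] obtain h :: "'a clifford \<Rightarrow> 'a exterior" where
    h: "Vector_Spaces.linear cliff_scale ext_scale h" "h 1 = 1"
      "\<And>z a. h (cliff_vec z * a) = L z (h a)"
    by blast
  have h_hom: "module_hom cliff_scale ext_scale h"
    using h(1) by (simp add: Vector_Spaces.linear_def)
  note h_linear = module_hom.add[OF h_hom] module_hom.scale[OF h_hom] module_hom.neg[OF h_hom]
  \<comment> \<open>The two mixed anticommutators are \<open>(x|y)\<close> and \<open>(y|x)\<close> with opposite signs, so they cancel.\<close>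
  have LR: "L x (R y a) = R y (L x a)" for x y a
    using ext_anti[of x y "ext.parity a"] ext.contraction_anticommute[of x y "ext.parity a"]
    by (simp add: L_def R_def cbilin_commute[of y x] ext.contraction_parity algebra_simps)
  have h_right: "h (a * cliff_vec x) = R x (h a)" for a x
  proof (induction a rule: cliff.induct)
    case one
    then show ?case using h(3)[of x 1] by (simp add: h(2) L_def R_def)
  next
    case (mult z a)
    then show ?case by (simp add: mult.assoc h LR)
  qed (simp_all add: h_linear R_def distrib_left distrib_right cliff.scale_mult_left
        ext.scale_mult_right ext.scale_right_diff_distrib)
  have h_parity: "h (cliff.parity a) = ext.parity (h a)" for a
    by (induction a rule: cliff.induct)
       (simp_all add: h h_linear L_def ext.contraction_parity)
  define \<tau> where "\<tau> a = \<epsilon> (h a)" for a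
  have "Vector_Spaces.linear cliff_scale (*) \<tau>"
    using cliff.vector_space_axioms vector_space_over_itself.vector_space_axioms
    by (simp add: Vector_Spaces.linear_iff \<tau>_def h_linear \<epsilon>_linear)
  moreover have vec_comm: "\<tau> (cliff_vec x * a) = \<tau> (a * cliff_vec x)" for x a
    by (simp add: \<tau>_def h h_right L_def R_def \<epsilon> \<epsilon>_linear ext.contraction_parity \<epsilon>_parity)
  have "\<tau> (a * b) = \<tau> (b * a)" for a b
  proof (induction a arbitrary: b rule: cliff.induct)
    case (mult z a)
    show ?case using mult[of "b * cliff_vec z"] vec_comm[of z "a * b"] by (simp add: mult.assoc)
  qed (simp_all add: \<tau>_def h_linear \<epsilon>_linear distrib_left distrib_right
        cliff.scale_mult_left cliff.scale_mult_right)
  moreover have "\<tau> \<circ> cliff.parity = \<tau>"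
    by (simp add: fun_eq_iff \<tau>_def h_parity \<epsilon>_parity)
  moreover have "\<tau> 1 = 1" by (simp add: \<tau>_def h \<epsilon>)
  ultimately show ?thesis unfolding is_trace_def by blast
qed

text \<open>
  Two traces satisfy the same contraction recursion.
\<close>

lemma trace_unique:
  assumes "is_trace \<tau>" "is_trace \<tau>'"
  shows "\<tau> = \<tau>'"
proof -
  have "Vector_Spaces.linear cliff_scale (*) (\<lambda>a. \<tau> a - \<tau>' a)"
    using assms by (simp add: is_trace_def Vector_Spaces.linear_iff algebra_simps)
  then have "\<tau> a - \<tau>' a = 0" for a
    by (rule cliff.contraction_recursion_unique[where K = "\<lambda>z. z"])
       (use assms in \<open>simp_all add: trace_vec_mult\<close>, simp add: is_trace_def)
  then show ?thesis by (simp add: fun_eq_iff)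
qed

lemma is_trace_cliff_trace: "is_trace cliff_trace"
proof -
  have "cliff_trace = (THE \<tau>. is_trace \<tau>)"
    by (simp add: cliff_trace_def is_trace_def cliff_parity_eq)
  then show ?thesis using trace_exists trace_unique by (metis theI)
qed

section \<open>Antinormal ordering\<close>

text \<open>
  An algebra homomorphism on \<open>ext_subalgebra W\<close> is determined by its values on \<open>W\<close>, so any map with the
  listed properties is the canonical embedding. The restriction matters because the embedding is
  required to be extensional.
\<close>

lemma isotropic_embedding_eqI:
  assumes "\<kappa> 1 = 1" "\<And>w. w \<in> W \<Longrightarrow> \<kappa> (ext_vec w) = cliff_vec w"
    "\<And>c \<alpha>. \<alpha> \<in> ext_subalgebra W \<Longrightarrow> \<kappa> (ext_scale c \<alpha>) = cliff_scale c (\<kappa> \<alpha>)"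
    "\<And>\<alpha> \<beta>. \<alpha> \<in> ext_subalgebra W \<Longrightarrow> \<beta> \<in> ext_subalgebra W \<Longrightarrow> \<kappa> (\<alpha> + \<beta>) = \<kappa> \<alpha> + \<kappa> \<beta>"
    "\<And>\<alpha> \<beta>. \<alpha> \<in> ext_subalgebra W \<Longrightarrow> \<beta> \<in> ext_subalgebra W \<Longrightarrow> \<kappa> (\<alpha> * \<beta>) = \<kappa> \<alpha> * \<kappa> \<beta>"
  shows "isotropic_embedding W = restrict \<kappa> (ext_subalgebra W)"
  unfolding isotropic_embedding_def
proof (rule the_equality, goal_cases)
  case 1
  show ?case by (simp add: assms ext_subalgebra.intros)
next
  case (2 \<kappa>')
  show ?case
  proof (rule extensionalityI[where A = "ext_subalgebra W"])
    fix \<alpha> assume "\<alpha> \<in> ext_subalgebra W"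
    then show "\<kappa>' \<alpha> = restrict \<kappa> (ext_subalgebra W) \<alpha>"
      by (induction rule: ext_subalgebra.induct) (use 2 in \<open>simp_all add: assms ext_subalgebra.intros\<close>)
  qed (use 2 in simp_all)
qed

lemma ext_subalgebra_parity: "\<alpha> \<in> ext_subalgebra W \<Longrightarrow> ext.parity \<alpha> \<in> ext_subalgebra W"
proof (induction rule: ext_subalgebra.induct)
  case (vec w)
  then show ?case
    using ext_subalgebra.scale[OF ext_subalgebra.vec, of w W "- 1"]
    by (simp add: ext.scale_minus_left)
qed (simp_all add: ext_subalgebra.intros ext.parity_mult)

lemma ext_vec_anticommute:
  fixes x z :: "'a::real_inner complexification"
  shows "ext_vec x * ext_vec z = - (ext_vec z * ext_vec x)"
  using ext.vec_polarization[of x z] by (simp add: eq_neg_iff_add_eq_0)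

text \<open>
  Supercommutativity of the wedge product, for one factor of degree \<open>1\<close>.
\<close>

lemma ext_vec_commute_parity: "ext_vec z * \<alpha> = ext.parity \<alpha> * ext_vec z"
proof (induction \<alpha> rule: ext.induct)
  case (mult w \<alpha>)
  have "ext_vec z * (ext_vec w * \<alpha>) = - (ext_vec w * (ext_vec z * \<alpha>))"
    using ext_vec_anticommute[of z w] by (simp flip: mult.assoc)
  then show ?case by (simp add: mult mult.assoc)
qed (simp_all add: distrib_left distrib_right ext.scale_mult_left ext.scale_mult_right)

lemma contraction_isotropic_eq_0:
  assumes "\<alpha> \<in> ext_subalgebra W" "\<And>w. w \<in> W \<Longrightarrow> cbilin x w = 0"
  shows "ext.contraction x \<alpha> = 0"
  using assms(1) by (induction rule: ext_subalgebra.induct) (simp_all add: assms(2) ext.contraction_mult)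

locale complex_structure =
  fixes J :: "'a::real_inner \<Rightarrow> 'a"
  assumes orthogonal_complex_structure: "orthogonal_complex_structure J"
begin

lemma linear_J: "linear J" and J_isometry: "J x \<bullet> J y = x \<bullet> y" and J_J: "J (J x) = - x"
  using orthogonal_complex_structure by (auto simp: orthogonal_complex_structure_def)

lemmas J_simps = linear_add[OF linear_J] linear_diff[OF linear_J] linear_neg[OF linear_J]
  linear_scale[OF linear_J] linear_0[OF linear_J] J_isometry J_J

lemma J_skew: "J x \<bullet> y = - (x \<bullet> J y)"
  using J_isometry[of x "J y"] by (simp add: J_J)

lemma J_inner_swap: "x \<bullet> J y = - (y \<bullet> J x)"
  using J_skew[of y x] by (simp add: inner_commute)

lemma J_inner_self: "x \<bullet> J x = 0"
  using J_inner_swap[of x x] by simp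

definition plus_part :: "'a complexification \<Rightarrow> 'a complexification" where
  "plus_part w = ((1/2) *\<^sub>R (fst w + J (snd w)), (1/2) *\<^sub>R (snd w - J (fst w)))"

definition minus_part :: "'a complexification \<Rightarrow> 'a complexification" where
  "minus_part w = ((1/2) *\<^sub>R (fst w - J (snd w)), (1/2) *\<^sub>R (snd w + J (fst w)))"

lemma minus_part_add_plus_part: "minus_part w + plus_part w = w"
  by (simp add: plus_part_def minus_part_def prod_eq_iff algebra_simps flip: scaleR_add_left)

lemma plus_part_in_eigenspace: "plus_part w \<in> eigenspace_plus J"
  by (simp add: plus_part_def eigenspace_plus_def cscale_def J_simps algebra_simps)

lemma minus_part_in_eigenspace: "minus_part w \<in> eigenspace_minus J"
  by (simp add: minus_part_def eigenspace_minus_def cscale_def J_simps algebra_simps)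

lemma plus_part_add: "plus_part (w + z) = plus_part w + plus_part z"
  by (simp add: plus_part_def J_simps algebra_simps)

lemma plus_part_cscale: "plus_part (cscale c w) = cscale c (plus_part w)"
  by (simp add: plus_part_def cscale_def J_simps algebra_simps)

lemma mem_eigenspace_plus_iff: "w \<in> eigenspace_plus J \<longleftrightarrow> snd w = - J (fst w)"
  by (cases w) (auto simp: eigenspace_plus_def cscale_def J_simps)

lemma mem_eigenspace_minus_iff: "w \<in> eigenspace_minus J \<longleftrightarrow> snd w = J (fst w)"
  by (cases w) (auto simp: eigenspace_minus_def cscale_def J_simps)

lemma plus_part_plus: "w \<in> eigenspace_plus J \<Longrightarrow> plus_part w = w"
  using scaleR_half_double[of "- J (fst w)"]
  by (simp add: mem_eigenspace_plus_iff plus_part_def J_simps prod_eq_iff)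

lemma plus_part_minus: "w \<in> eigenspace_minus J \<Longrightarrow> plus_part w = 0"
  by (simp add: mem_eigenspace_minus_iff plus_part_def J_simps zero_prod_def)

lemma eigenspace_plus_isotropic:
  "w \<in> eigenspace_plus J \<Longrightarrow> z \<in> eigenspace_plus J \<Longrightarrow> cbilin w z = 0"
  by (simp add: mem_eigenspace_plus_iff cbilin_def J_simps J_skew complex_eq_iff)

lemma eigenspace_minus_isotropic:
  "w \<in> eigenspace_minus J \<Longrightarrow> z \<in> eigenspace_minus J \<Longrightarrow> cbilin w z = 0"
  by (simp add: mem_eigenspace_minus_iff cbilin_def J_simps J_skew complex_eq_iff)

lemma cbilin_plus_part: "2 * cbilin (plus_part z) z = cbilin z z"
  using J_inner_swap[of "fst z" "snd z"]
  by (simp add: plus_part_def cbilin_def J_skew J_inner_self complex_eq_iff inner_commute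
      algebra_simps)

text \<open>
  The candidate for the antinormal ordering. A vector of the minus eigenspace acts by Clifford
  multiplication. For \<open>b\<close> in the plus eigenspace, \<open>b \<alpha> = \<Gamma>(\<alpha>) b + 2 \<iota>\<^sub>b \<alpha>\<close>, and subtracting
  \<open>2 \<iota>\<^sub>b\<close> amounts to moving \<open>b\<close> to the right of all minus vectors as if it anticommuted with them.
\<close>

definition nu :: "'a exterior \<Rightarrow> 'a clifford" where
  "nu = (SOME h. Vector_Spaces.linear ext_scale cliff_scale h \<and> h 1 = 1 \<and>
     (\<forall>z a. h (ext_vec z * a) =
        cliff_vec z * h a - cliff_scale 2 (cliff.contraction (plus_part z) (h a))))"

lemma nu_spec:
  "Vector_Spaces.linear ext_scale cliff_scale nu \<and> nu 1 = 1 \<and>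
     (\<forall>z a. nu (ext_vec z * a) =
        cliff_vec z * nu a - cliff_scale 2 (cliff.contraction (plus_part z) (nu a)))"
proof -
  define N where "N z a = cliff_vec z * a - cliff_scale 2 (cliff.contraction (plus_part z) a)"
    for z and a :: "'a clifford"
  \<comment> \<open>The mixed terms give \<open>2 (z\<^sup>+|z)\<close>, which isotropy of the eigenspaces turns into \<open>(z|z)\<close>.\<close>
  have square: "N z (N z a) = cliff_scale 0 a" for z a
  proof -
    have "N z (N z a) = cliff_vec z * cliff_vec z * a -
        cliff_scale (2 * cbilin (plus_part z) z) a"
      by (simp add: N_def algebra_simps cliff.scale_mult_right cliff.scale_right_diff_distrib
          cliff.contraction_contraction)
    then show ?thesis
      by (simp add: cliff_vec_square cbilin_plus_part cliff.scale_mult_left)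
  qed
  have "quadratic_module cliff_scale (\<lambda>_. 0) N"
  proof (unfold_locales, rule_tac [5] square)
    show "N z (x + y) = N z x + N z y" for z x y
      by (simp add: N_def distrib_left cliff.scale_right_distrib)
    show "N z (cliff_scale c x) = cliff_scale c (N z x)" for z c x
      by (simp add: N_def cliff.scale_mult_right cliff.scale_right_diff_distrib mult.commute)
    show "N (w + z) x = N w x + N z x" for w z x
      by (simp add: N_def cliff.vec_add plus_part_add cliff.contraction_add_left distrib_right
          cliff.scale_right_distrib)
    show "N (cscale c z) x = cliff_scale c (N z x)" for c z x
      by (simp add: N_def cliff.vec_scale plus_part_cscale cliff.contraction_cscale_left
          cliff.scale_mult_left cliff.scale_right_diff_distrib mult.commute)
  qed
  from ext.lift[OF this, of 1] obtain h :: "'a exterior \<Rightarrow> 'a clifford" where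
    "Vector_Spaces.linear ext_scale cliff_scale h" "h 1 = 1" "\<And>z a. h (ext_vec z * a) = N z (h a)"
    by blast
  then have "\<exists>h. Vector_Spaces.linear ext_scale cliff_scale h \<and> h 1 = 1 \<and>
     (\<forall>z a. h (ext_vec z * a) =
        cliff_vec z * h a - cliff_scale 2 (cliff.contraction (plus_part z) (h a)))"
    unfolding N_def by blast
  then show ?thesis unfolding nu_def by (rule someI_ex)
qed

lemma module_hom_nu: "module_hom ext_scale cliff_scale nu"
  using nu_spec by (simp add: Vector_Spaces.linear_def)

lemmas nu_linear [simp] =
  module_hom.add[OF module_hom_nu] module_hom.scale[OF module_hom_nu]
  module_hom.zero[OF module_hom_nu] module_hom.neg[OF module_hom_nu]
  module_hom.diff[OF module_hom_nu]

lemma nu_one [simp]: "nu 1 = 1"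
  using nu_spec by blast

lemma nu_vec_mult: "nu (ext_vec z * a) =
    cliff_vec z * nu a - cliff_scale 2 (cliff.contraction (plus_part z) (nu a))"
  using nu_spec by blast

lemma nu_vec: "nu (ext_vec z) = cliff_vec z"
  using nu_vec_mult[of z 1] by simp

text \<open>
  Clifford multiplication by \<open>z\<close> has the same commutation rule with \<open>\<iota>\<^sub>x\<close> as wedge multiplication, and
  the correction term, itself a contraction, anticommutes with \<open>\<iota>\<^sub>x\<close>.
\<close>

lemma nu_contraction: "nu (ext.contraction x a) = cliff.contraction x (nu a)"
proof (induction a rule: ext.induct)
  case (mult z a)
  show ?case
    using cliff.contraction_anticommute[of x "plus_part z" "nu a"]
    by (simp add: nu_vec_mult mult)
qed simp_all

lemma nu_mult_minus:
  "\<alpha> \<in> ext_subalgebra (eigenspace_minus J) \<Longrightarrow> nu (\<alpha> * \<zeta>) = nu \<alpha> * nu \<zeta>"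
proof (induction arbitrary: \<zeta> rule: ext_subalgebra.induct)
  case (vec w)
  have "cliff.contraction (plus_part w) (nu \<zeta>) = 0"
    using cliff.contraction_cscale_left[of 0 0 "nu \<zeta>"]
    by (simp add: plus_part_minus vec cscale_def zero_prod_def)
  then show ?case by (simp add: nu_vec_mult nu_vec)
qed (simp_all add: distrib_right ext.scale_mult_left cliff.scale_mult_left mult.assoc)

text \<open>
  The correction term \<open>\<iota>\<^sub>w\<close> vanishes on products of plus vectors because the plus eigenspace is
  isotropic; \<open>nu_contraction\<close> transfers this from the exterior algebra, where it is immediate.
\<close>

lemma nu_mult_plus:
  "\<alpha> \<in> ext_subalgebra (eigenspace_plus J) \<Longrightarrow> \<beta> \<in> ext_subalgebra (eigenspace_plus J) \<Longrightarrow>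
    nu (\<alpha> * \<beta>) = nu \<alpha> * nu \<beta>"
proof (induction arbitrary: \<beta> rule: ext_subalgebra.induct)
  case (vec w)
  have "cliff.contraction w (nu \<beta>) = 0"
    using contraction_isotropic_eq_0[OF vec(2), of w] vec(1)
    by (simp add: eigenspace_plus_isotropic flip: nu_contraction)
  then show ?case by (simp add: nu_vec_mult nu_vec plus_part_plus vec)
qed (simp_all add: distrib_right ext.scale_mult_left cliff.scale_mult_left mult.assoc
      ext_subalgebra.mult)

lemma isotropic_embedding_minus:
  "isotropic_embedding (eigenspace_minus J) = restrict nu (ext_subalgebra (eigenspace_minus J))"
  by (rule isotropic_embedding_eqI) (simp_all add: nu_vec nu_mult_minus)

lemma isotropic_embedding_plus:
  "isotropic_embedding (eigenspace_plus J) = restrict nu (ext_subalgebra (eigenspace_plus J))"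
  by (rule isotropic_embedding_eqI) (simp_all add: nu_vec nu_mult_plus)

text \<open>
  This gives the uniqueness of the antinormal ordering. Closure under left multiplication by a vector
  \<open>z\<close> suffices, and there \<open>z\<^sup>+\<close> is moved past \<open>\<alpha>\<close> by supercommutativity.
\<close>

lemma minus_plus_products_span:
  "\<zeta> \<in> ext.span {\<alpha> * \<beta> |\<alpha> \<beta>. \<alpha> \<in> ext_subalgebra (eigenspace_minus J) \<and>
     \<beta> \<in> ext_subalgebra (eigenspace_plus J)}" (is "_ \<in> ext.span ?S")
proof (induction \<zeta> rule: ext.induct)
  case one
  have "1 * 1 \<in> ?S" using ext_subalgebra.one by blast
  then show ?case by (simp add: ext.span_base)
next
  case (mult z \<zeta>)
  from mult show ?case
  proof (induction rule: ext.span_induct_alt)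
    case base
    show ?case by (simp add: ext.span_zero)
  next
    case (step c x y)
    then obtain \<alpha> \<beta> where x: "x = \<alpha> * \<beta>" and \<alpha>: "\<alpha> \<in> ext_subalgebra (eigenspace_minus J)"
      and \<beta>: "\<beta> \<in> ext_subalgebra (eigenspace_plus J)"
      by blast
    have "ext_vec z * x =
        (ext_vec (minus_part z) * \<alpha>) * \<beta> + ext.parity \<alpha> * (ext_vec (plus_part z) * \<beta>)"
      by (subst minus_part_add_plus_part[of z, symmetric])
         (simp add: x ext.vec_add distrib_right ext_vec_commute_parity[of "plus_part z" \<alpha>]
            flip: mult.assoc)
    moreover have "(ext_vec (minus_part z) * \<alpha>) * \<beta> \<in> ?S"
      using \<alpha> \<beta> minus_part_in_eigenspace ext_subalgebra.mult ext_subalgebra.vec by blast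
    moreover have "ext.parity \<alpha> * (ext_vec (plus_part z) * \<beta>) \<in> ?S"
      using \<alpha> \<beta> plus_part_in_eigenspace ext_subalgebra.mult ext_subalgebra.vec
        ext_subalgebra_parity by blast
    ultimately have "ext_vec z * x \<in> ext.span ?S"
      by (simp add: ext.span_add ext.span_base)
    then show ?case
      using step by (simp add: distrib_left ext.scale_mult_right ext.span_add ext.span_scale)
  qed
qed (simp_all add: ext.span_add ext.span_scale)

lemma antinormal_eq: "antinormal J = nu"
  unfolding antinormal_def
proof (rule the_equality, goal_cases)
  case 1
  show ?case
    using nu_spec
    by (simp add: isotropic_embedding_minus isotropic_embedding_plus nu_mult_minus)
next
  case (2 \<nu>)
  then have hom: "module_hom ext_scale cliff_scale \<nu>"
    by (simp add: Vector_Spaces.linear_def)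
  note linear = module_hom.add[OF hom] module_hom.scale[OF hom] module_hom.zero[OF hom]
  have "\<nu> \<zeta> = nu \<zeta>" for \<zeta>
    using minus_plus_products_span[of \<zeta>]
  proof (induction rule: ext.span_induct_alt)
    case (step c x y)
    then obtain \<alpha> \<beta> where "x = \<alpha> * \<beta>" "\<alpha> \<in> ext_subalgebra (eigenspace_minus J)"
      "\<beta> \<in> ext_subalgebra (eigenspace_plus J)"
      by blast
    then have "\<nu> x = nu x"
      using 2 by (simp add: isotropic_embedding_minus isotropic_embedding_plus nu_mult_minus)
    then show ?case using step by (simp add: linear)
  qed (simp add: linear)
  then show ?case by blast
qed

text \<open>
  The vector \<open>z\<^sup>- - z\<^sup>+\<close>, written as \<open>z - 2 z\<^sup>+\<close>.
\<close>

definition negate_plus :: "'a complexification \<Rightarrow> 'a complexification" where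
  "negate_plus z = z + cscale (- 2) (plus_part z)"

lemma trace_nu_vec_mult:
  "cliff_trace (nu (ext_vec z * \<zeta>)) = cliff_trace (nu (ext.contraction (negate_plus z) \<zeta>))"
proof -
  have hom: "module_hom cliff_scale (*) (cliff_trace :: 'a clifford \<Rightarrow> complex)"
    using is_trace_cliff_trace by (auto simp: is_trace_def Vector_Spaces.linear_def)
  show ?thesis
    by (simp add: nu_vec_mult negate_plus_def ext.contraction_add_left ext.contraction_cscale_left
        nu_contraction trace_vec_mult[OF is_trace_cliff_trace] module_hom.diff[OF hom]
        module_hom.add[OF hom] module_hom.neg[OF hom] module_hom.scale[OF hom])
qed

end

section \<open>Unitary bases\<close>

context complex_structure
begin

sublocale J: vector_space "scale_J J"
  by unfold_locales (simp_all add: scale_J_def J_simps algebra_simps)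

lemma inner_J_add_right: "inner_J J x (y + z) = inner_J J x y + inner_J J x z"
  by (simp add: inner_J_def complex_eq_iff inner_add_right)

lemma inner_J_scale_right: "inner_J J x (scale_J J c y) = c * inner_J J x y"
  by (simp add: inner_J_def scale_J_def complex_eq_iff inner_add_right J_skew J_simps algebra_simps)

lemma inner_J_commute: "inner_J J y x = cnj (inner_J J x y)"
  by (simp add: inner_J_def complex_eq_iff inner_commute J_inner_swap[of x y] J_skew)

lemma inner_J_self: "inner_J J x x = complex_of_real (x \<bullet> x)"
  by (simp add: inner_J_def complex_eq_iff J_skew J_inner_self)

lemma inner_J_zero_right [simp]: "inner_J J x 0 = 0"
  by (simp add: inner_J_def complex_eq_iff)

lemma inner_J_diff_right: "inner_J J x (y - z) = inner_J J x y - inner_J J x z"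
  by (simp add: inner_J_def complex_eq_iff inner_diff_right)

lemma inner_J_sum_right: "inner_J J x (sum f A) = (\<Sum>i\<in>A. inner_J J x (f i))"
  by (induction A rule: infinite_finite_induct) (simp_all add: inner_J_add_right)

lemma inner_J_span_eq_0:
  assumes "y \<in> J.span B" "\<And>b. b \<in> B \<Longrightarrow> inner_J J x b = 0"
  shows "inner_J J x y = 0"
  using assms(1)
  by (induction rule: J.span_induct_alt) (simp_all add: assms(2) inner_J_add_right inner_J_scale_right)

definition orthonormal :: "'a set \<Rightarrow> bool" where
  "orthonormal B \<longleftrightarrow> (\<forall>b\<in>B. \<forall>c\<in>B. inner_J J b c = (if b = c then 1 else 0))"

lemma orthonormal_independent:
  assumes "orthonormal B"
  shows "J.independent B"
  unfolding J.independent_explicit_module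
proof (intro allI impI)
  fix T u b
  assume T: "finite T" "T \<subseteq> B" and sum: "(\<Sum>c\<in>T. scale_J J (u c) c) = 0" and b: "b \<in> T"
  have "0 = (\<Sum>c\<in>T. u c * inner_J J b c)"
    using arg_cong[OF sum, of "inner_J J b"] by (simp add: inner_J_sum_right inner_J_scale_right)
  also have "\<dots> = (\<Sum>c\<in>T. if b = c then u c else 0)"
  proof (intro sum.cong refl)
    fix c assume "c \<in> T"
    then have "inner_J J b c = (if b = c then 1 else 0)"
      using assms T b unfolding orthonormal_def by blast
    then show "u c * inner_J J b c = (if b = c then u c else 0)" by simp
  qed
  finally show "u b = 0" using T b by simp
qed

text \<open>
  One step of the Gram-Schmidt process.
\<close>

lemma orthonormal_extend:
  assumes B: "orthonormal B" "finite B" and x: "x \<notin> J.span B"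
  obtains e where "e \<notin> B" "orthonormal (insert e B)"
proof -
  define y where "y = x - (\<Sum>b\<in>B. scale_J J (inner_J J b x) b)"
  have "y \<noteq> 0"
  proof
    assume "y = 0"
    then have "x = (\<Sum>b\<in>B. scale_J J (inner_J J b x) b)" by (simp add: y_def)
    moreover have "\<dots> \<in> J.span B" by (intro J.span_sum J.span_scale J.span_base)
    ultimately show False using x by simp
  qed
  have y_orth: "inner_J J b y = 0" if "b \<in> B" for b
  proof -
    have "(\<Sum>c\<in>B. inner_J J c x * inner_J J b c) = (\<Sum>c\<in>B. if b = c then inner_J J c x else 0)"
      using B that by (intro sum.cong) (auto simp: orthonormal_def)
    then show ?thesis
      using B that by (simp add: y_def inner_J_diff_right inner_J_sum_right inner_J_scale_right)
  qed
  define e where "e = scale_J J (complex_of_real (1 / norm y)) y"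
  have e_orth: "inner_J J b e = 0" if "b \<in> B" for b
    using y_orth[OF that] by (simp add: e_def inner_J_scale_right)
  have e_orth': "inner_J J e b = 0" if "b \<in> B" for b
    using e_orth[OF that] by (subst inner_J_commute) simp
  have "e = (1 / norm y) *\<^sub>R y" by (simp add: e_def scale_J_def)
  then have "e \<bullet> e = 1"
    using \<open>y \<noteq> 0\<close> by (simp add: power2_norm_eq_inner[symmetric] power2_eq_square)
  then have e_self: "inner_J J e e = 1" by (simp add: inner_J_self)
  have "e \<notin> B" using e_orth[of e] e_self by auto
  moreover have "orthonormal (insert e B)"
    using B e_orth e_orth' e_self by (auto simp: orthonormal_def)
  ultimately show thesis by (rule that)
qed

text \<open>
  Orthonormal sets are linearly independent over the complex numbers, so their cardinality is bounded, and one of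
  maximal cardinality spans by \<open>orthonormal_extend\<close>.
\<close>

lemma unitary_basis_exists:
  assumes "\<exists>B :: 'a set. finite B \<and> span B = UNIV"
  shows "\<exists>v. unitary_basis J v"
proof -
  obtain T :: "'a set" where T: "finite T" "span T = UNIV" using assms by blast
  \<comment> \<open>A real spanning set is a complex one.\<close>
  have "x \<in> J.span T" for x
  proof -
    have "x \<in> span T" using T by simp
    then show ?thesis
    proof (induction rule: span_induct_alt)
      case (step c x y)
      have "c *\<^sub>R x = scale_J J (complex_of_real c) x" by (simp add: scale_J_def)
      then show ?case using step by (simp add: J.span_add J.span_scale J.span_base)
    qed (rule J.span_zero)
  qed
  then have bound: "finite B \<and> card B \<le> card T" if "orthonormal B" for B
    using J.independent_span_bound[OF T(1) orthonormal_independent[OF that]] by blast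
  have "orthonormal {}" by (simp add: orthonormal_def)
  then have "\<exists>B. orthonormal B \<and> (\<forall>C. orthonormal C \<longrightarrow> card C \<le> card B)"
    by (rule ex_has_greatest_nat[where b = "Suc (card T)"]) (use bound in \<open>auto simp: less_Suc_eq_le\<close>)
  then obtain B where B: "orthonormal B" and max: "\<And>C. orthonormal C \<Longrightarrow> card C \<le> card B"
    by blast
  have fin: "finite B" using bound B by blast
  have span: "J.span B = UNIV"
  proof (rule ccontr)
    assume "J.span B \<noteq> UNIV"
    then obtain x where "x \<notin> J.span B" by blast
    with B fin obtain e where "e \<notin> B" "orthonormal (insert e B)"
      using orthonormal_extend by blast
    then show False using max[of "insert e B"] fin by simp
  qed
  have dim: "card B = dim_J J"
    unfolding dim_J_def
    using J.basis_card_eq_dim[of B UNIV] span orthonormal_independent[OF B] by simp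
  obtain v where v: "bij_betw v {1..card B} B"
    using ex_bij_betw_nat_finite_1[OF fin] by blast
  have img: "v ` {1..dim_J J} = B" and inj: "inj_on v {1..dim_J J}"
    using v by (simp_all add: bij_betw_def dim)
  have "unitary_basis J v"
    unfolding unitary_basis_def img
  proof (intro conjI ballI span)
    fix m n assume mn: "m \<in> {1..dim_J J}" "n \<in> {1..dim_J J}"
    then have "v m \<in> B" "v n \<in> B" using img by auto
    moreover have "v m = v n \<longleftrightarrow> m = n"
      by (rule inj_on_eq_iff[OF inj mn])
    ultimately show "inner_J J (v m) (v n) = (if m = n then 1 else 0)"
      using B by (simp add: orthonormal_def)
  qed
  then show ?thesis by blast
qed

lemma unitary_basis_expansion:
  assumes v: "unitary_basis J v"
  shows "x = (\<Sum>m = 1..dim_J J. scale_J J (inner_J J (v m) x) (v m))"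
proof -
  define y where "y = x - (\<Sum>m = 1..dim_J J. scale_J J (inner_J J (v m) x) (v m))"
  have "inner_J J (v n) y = 0" if "n \<in> {1..dim_J J}" for n
  proof -
    have "(\<Sum>m = 1..dim_J J. inner_J J (v m) x * inner_J J (v n) (v m)) =
        (\<Sum>m = 1..dim_J J. if n = m then inner_J J (v m) x else 0)"
      using v that by (intro sum.cong) (auto simp: unitary_basis_def)
    then show ?thesis
      using that by (simp add: y_def inner_J_diff_right inner_J_sum_right inner_J_scale_right)
  qed
  then have "inner_J J y (v n) = 0" if "n \<in> {1..dim_J J}" for n
    using that inner_J_commute[of y "v n"] by simp
  moreover have "y \<in> J.span (v ` {1..dim_J J})"
    using v by (simp add: unitary_basis_def)
  ultimately have "inner_J J y y = 0" using inner_J_span_eq_0 by blast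
  then show ?thesis by (simp add: inner_J_self y_def)
qed

lemma gamma_plus_add: "gamma_plus J (x + y) = gamma_plus J x + gamma_plus J y"
  by (simp add: gamma_plus_def J_simps algebra_simps)

lemma gamma_minus_add: "gamma_minus J (x + y) = gamma_minus J x + gamma_minus J y"
  by (simp add: gamma_minus_def J_simps algebra_simps)

lemma gamma_plus_scale_J: "gamma_plus J (scale_J J c x) = cscale c (gamma_plus J x)"
  by (simp add: gamma_plus_def scale_J_def cscale_def J_simps algebra_simps)

lemma gamma_minus_scale_J: "gamma_minus J (scale_J J c x) = cscale (cnj c) (gamma_minus J x)"
  by (simp add: gamma_minus_def scale_J_def cscale_def J_simps algebra_simps)

lemma cbilin_gamma: "cbilin (gamma_plus J x) (gamma_minus J y) = inner_J J y x"
  using J_inner_swap[of x y]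
  by (simp add: gamma_plus_def gamma_minus_def cbilin_def inner_J_def complex_eq_iff J_simps J_skew
      inner_commute field_simps flip: power2_eq_square)

lemma eigenspace_plus_eq: "b \<in> eigenspace_plus J \<Longrightarrow> gamma_plus J (sqrt 2 *\<^sub>R fst b) = b"
  by (simp add: mem_eigenspace_plus_iff gamma_plus_def J_simps prod_eq_iff)

lemma eigenspace_minus_eq: "a \<in> eigenspace_minus J \<Longrightarrow> gamma_minus J (sqrt 2 *\<^sub>R fst a) = a"
  by (simp add: mem_eigenspace_minus_iff gamma_minus_def J_simps prod_eq_iff)

text \<open>
  Every plus vector is \<open>\<gamma>\<^sup>+(x)\<close>, and applying the complex-linear \<open>\<gamma>\<^sup>+\<close> to the unitary expansion of
  \<open>x\<close> gives coefficients that are read off by pairing with the dual vectors \<open>\<gamma>\<^sup>-(v\<^sub>m)\<close>. The expansion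
  is stated in the exterior algebra, where it is used.
\<close>

lemma ext_vec_plus_expansion:
  assumes v: "unitary_basis J v" and b: "b \<in> eigenspace_plus J"
  shows "ext_vec b = (\<Sum>m = 1..dim_J J.
    ext_scale (cbilin b (gamma_minus J (v m))) (ext_vec (gamma_plus J (v m))))"
proof -
  define h where "h x = ext_vec (gamma_plus J x)" for x
  have h_add: "h (x + y) = h x + h y" and h_scale: "h (scale_J J c x) = ext_scale c (h x)" for x y c
    by (simp_all add: h_def gamma_plus_add ext.vec_add gamma_plus_scale_J ext.vec_scale)
  have "h 0 = 0" using h_add[of 0 0] by simp
  then have h_sum: "h (sum f A) = (\<Sum>i\<in>A. h (f i))" for f :: "nat \<Rightarrow> 'a" and A
    by (induction A rule: infinite_finite_induct) (simp_all add: h_add)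
  define x where "x = sqrt 2 *\<^sub>R fst b"
  have bx: "b = gamma_plus J x" using eigenspace_plus_eq[OF b] by (simp add: x_def)
  have "h x = (\<Sum>m = 1..dim_J J. ext_scale (inner_J J (v m) x) (h (v m)))"
    by (subst unitary_basis_expansion[OF v, of x]) (simp only: h_sum h_scale)
  then show ?thesis by (simp add: bx cbilin_gamma h_def)
qed

lemma ext_vec_minus_expansion:
  assumes v: "unitary_basis J v" and a: "a \<in> eigenspace_minus J"
  shows "ext_vec a = (\<Sum>m = 1..dim_J J.
    ext_scale (cbilin a (gamma_plus J (v m))) (ext_vec (gamma_minus J (v m))))"
proof -
  define h where "h x = ext_vec (gamma_minus J x)" for x
  have h_add: "h (x + y) = h x + h y" and h_scale: "h (scale_J J c x) = ext_scale (cnj c) (h x)"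
    for x y c
    by (simp_all add: h_def gamma_minus_add ext.vec_add gamma_minus_scale_J ext.vec_scale)
  have "h 0 = 0" using h_add[of 0 0] by simp
  then have h_sum: "h (sum f A) = (\<Sum>i\<in>A. h (f i))" for f :: "nat \<Rightarrow> 'a" and A
    by (induction A rule: infinite_finite_induct) (simp_all add: h_add)
  define x where "x = sqrt 2 *\<^sub>R fst a"
  have ax: "a = gamma_minus J x" using eigenspace_minus_eq[OF a] by (simp add: x_def)
  have "h x = (\<Sum>m = 1..dim_J J. ext_scale (cnj (inner_J J (v m) x)) (h (v m)))"
    by (subst unitary_basis_expansion[OF v, of x]) (simp only: h_sum h_scale)
  moreover have "cnj (inner_J J (v m) x) = cbilin a (gamma_plus J (v m))" for m
    by (simp only: ax cbilin_commute[of "gamma_minus J x"] cbilin_gamma inner_J_commute[of x])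
  ultimately show ?thesis by (simp add: ax h_def)
qed

text \<open>
  Expanding the minus factors of one sum in the other basis, exchanging the sums and recognising the
  expansion of the plus vectors avoids any mention of the unitary matrix between the bases.
\<close>

lemma gamma_independent_of_basis:
  assumes v: "unitary_basis J v" and w: "unitary_basis J w"
  shows "(\<Sum>n = 1..dim_J J. ext_vec (gamma_plus J (w n)) * ext_vec (gamma_minus J (w n))) =
    (\<Sum>m = 1..dim_J J. ext_vec (gamma_plus J (v m)) * ext_vec (gamma_minus J (v m)))"
proof -
  let ?I = "{1..dim_J J}"
  let ?c = "\<lambda>m n. cbilin (gamma_plus J (v m)) (gamma_minus J (w n))"
  have "(\<Sum>n\<in>?I. ext_vec (gamma_plus J (w n)) * ext_vec (gamma_minus J (w n))) =
      (\<Sum>n\<in>?I. \<Sum>m\<in>?I. ext_scale (?c m n) (ext_vec (gamma_plus J (w n))) *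
         ext_vec (gamma_minus J (v m)))"
  proof (intro sum.cong refl)
    fix n
    have "ext_vec (gamma_minus J (w n)) = (\<Sum>m\<in>?I. ext_scale (?c m n) (ext_vec (gamma_minus J (v m))))"
      unfolding cbilin_commute[of "gamma_plus J _"]
      by (intro ext_vec_minus_expansion[OF v] gamma_minus_in_eigenspace
          orthogonal_complex_structure)
    then show "ext_vec (gamma_plus J (w n)) * ext_vec (gamma_minus J (w n)) =
        (\<Sum>m\<in>?I. ext_scale (?c m n) (ext_vec (gamma_plus J (w n))) * ext_vec (gamma_minus J (v m)))"
      by (simp only: sum_distrib_left ext.scale_mult_left ext.scale_mult_right)
  qed
  also have "\<dots> = (\<Sum>m\<in>?I. (\<Sum>n\<in>?I. ext_scale (?c m n) (ext_vec (gamma_plus J (w n)))) *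
         ext_vec (gamma_minus J (v m)))"
    by (subst sum.swap) (simp only: sum_distrib_right)
  also have "\<dots> = (\<Sum>m\<in>?I. ext_vec (gamma_plus J (v m)) * ext_vec (gamma_minus J (v m)))"
    by (intro sum.cong refl arg_cong2[of _ _ _ _ "(*)"]
        ext_vec_plus_expansion[OF w, symmetric]
        gamma_plus_in_eigenspace[OF orthogonal_complex_structure])
  finally show ?thesis .
qed

lemma berezin_gamma_eq:
  assumes "unitary_basis J v"
  shows "berezin_gamma J =
    (\<Sum>m = 1..dim_J J. ext_vec (gamma_plus J (v m)) * ext_vec (gamma_minus J (v m)))"
  unfolding berezin_gamma_def
  by (rule the_equality) (use assms gamma_independent_of_basis in blast)+

end

section \<open>The grading of the exterior algebra\<close>

lemma (in quadratic_algebra) contraction_word_orthogonal: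
  "(\<And>z. z \<in> set zs \<Longrightarrow> cbilin x z = 0) \<Longrightarrow> contraction x (prod_list (map vec zs)) = 0"
  by (induction zs) simp_all

lemma ext_power_eq: "(ext_power n :: 'a::real_inner exterior set) = ext.homogeneous n"
  by (simp add: ext_power_def ext.homogeneous_def)

text \<open>
  All homogeneous components at once: a vector acts on sequences by a shift of one place combined with
  multiplication, and the components of \<open>a\<close> are the terms of \<open>a\<close> applied to \<open>(1, 0, 0, \<dots>)\<close>.
\<close>

definition grading :: "'a::real_inner exterior \<Rightarrow> nat \<Rightarrow> 'a exterior" where
  "grading = (SOME h. Vector_Spaces.linear ext_scale (\<lambda>c g n. ext_scale c (g n)) h \<and>
     h 1 = (\<lambda>n. if n = 0 then 1 else 0) \<and>
     (\<forall>z a. h (ext_vec z * a) = case_nat 0 (\<lambda>n. ext_vec z * h a n)))"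

definition graded_part :: "nat \<Rightarrow> 'a::real_inner exterior \<Rightarrow> 'a exterior" where
  "graded_part k a = grading a k"

lemma graded_part_spec:
  "graded_part k (a + b :: 'a::real_inner exterior) = graded_part k a + graded_part k b"
  "graded_part k (ext_scale c a) = ext_scale c (graded_part k a)"
  "graded_part k (1 :: 'a exterior) = (if k = 0 then 1 else 0)"
  "graded_part 0 (ext_vec z * a) = 0"
  "graded_part (Suc n) (ext_vec z * a) = ext_vec z * graded_part n a"
proof -
  let ?s = "\<lambda>c (g :: nat \<Rightarrow> 'a exterior) n. ext_scale c (g n)"
  let ?f = "\<lambda>z (g :: nat \<Rightarrow> 'a exterior). case_nat 0 (\<lambda>n. ext_vec z * g n)"
  have "quadratic_module ?s (\<lambda>_. 0) ?f"
    by unfold_locales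
      (auto simp: fun_eq_iff ext.scale_right_distrib ext.scale_left_distrib ext.vec_add
        ext.vec_scale ext.scale_mult_left ext.scale_mult_right distrib_left distrib_right
        ext_vec_square split: nat.splits simp flip: mult.assoc)
  then obtain h where "Vector_Spaces.linear ext_scale ?s h" "h 1 = (\<lambda>n. if n = 0 then 1 else 0)"
    "\<And>z a. h (ext_vec z * a) = ?f z (h a)"
  proof (rule ext.lift[where x = "\<lambda>n. if n = 0 then 1 else 0"], goal_cases)
    case (1 h)
    from 1(2-) show ?case by (rule 1(1))
  qed
  then have "\<exists>h. Vector_Spaces.linear ext_scale ?s h \<and> h 1 = (\<lambda>n. if n = 0 then 1 else 0) \<and>
     (\<forall>z a. h (ext_vec z * a) = ?f z (h a))"
    by (intro exI[of _ h] conjI allI)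
  then have "Vector_Spaces.linear ext_scale ?s grading \<and>
      grading (1 :: 'a exterior) = (\<lambda>n. if n = 0 then 1 else 0) \<and>
      (\<forall>z a. grading (ext_vec z * a) = ?f z (grading a))"
    unfolding grading_def by (rule someI_ex)
  then show "graded_part k (a + b :: 'a exterior) = graded_part k a + graded_part k b"
    "graded_part k (ext_scale c a) = ext_scale c (graded_part k a)"
    "graded_part k (1 :: 'a exterior) = (if k = 0 then 1 else 0)"
    "graded_part 0 (ext_vec z * a) = 0"
    "graded_part (Suc n) (ext_vec z * a) = ext_vec z * graded_part n a"
    by (simp_all add: graded_part_def Vector_Spaces.linear_iff del: split_paired_All)
qed

lemma module_hom_graded_part:
  "module_hom ext_scale ext_scale (graded_part k :: 'a::real_inner exterior \<Rightarrow> 'a exterior)"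
  by (simp add: module_hom_iff ext.module_axioms graded_part_spec)

lemmas graded_part_linear [simp] =
  module_hom.add[OF module_hom_graded_part] module_hom.scale[OF module_hom_graded_part]
  module_hom.zero[OF module_hom_graded_part] module_hom.neg[OF module_hom_graded_part]
  module_hom.diff[OF module_hom_graded_part] module_hom.sum[OF module_hom_graded_part]

lemma graded_part_word:
  "graded_part k (prod_list (map ext_vec zs)) =
     (if length zs = k then prod_list (map ext_vec zs) else 0)"
proof (induction zs arbitrary: k)
  case (Cons z zs)
  then show ?case by (cases k) (simp_all add: graded_part_spec)
qed (simp add: graded_part_spec)

lemma graded_part_homogeneous:
  assumes "a \<in> ext.homogeneous n"
  shows "graded_part k a = (if n = k then a else 0)"
  using assms by (induction rule: ext.homogeneous_induct) (simp_all add: graded_part_word)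

lemma ext_component_eq: "ext_component k \<zeta> = graded_part k (\<zeta> :: 'a::real_inner exterior)"
  unfolding ext_component_def
proof (rule the_equality)
  let ?U = "\<Union>j\<in>- {k}. ext_power j :: 'a exterior set"
  have words: "prod_list (map ext_vec zs) \<in> ext_power (length zs)" for zs :: "'a complexification list"
    by (simp add: ext_power_eq ext.word_in_homogeneous)
  have "graded_part k \<zeta> \<in> ext_power k"
    by (induction \<zeta> rule: ext.word_induct)
      (auto simp: ext_power_eq graded_part_word ext.homogeneous_closed ext.word_in_homogeneous)
  moreover have "\<zeta> - graded_part k \<zeta> \<in> ext.span ?U"
  proof (induction \<zeta> rule: ext.word_induct)
    case (step c zs b)
    let ?w = "prod_list (map ext_vec zs)"
    have "?w - graded_part k ?w \<in> ext.span ?U"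
      using words[of zs]
      by (cases "length zs = k") (auto simp: graded_part_word ext.span_zero intro!: ext.span_base)
    then have "ext_scale c (?w - graded_part k ?w) + (b - graded_part k b) \<in> ext.span ?U"
      using step by (intro ext.span_add ext.span_scale)
    then show ?case by (simp add: ext.scale_right_diff_distrib algebra_simps)
  qed (simp add: ext.span_zero)
  ultimately show "graded_part k \<zeta> \<in> ext_power k \<and> \<zeta> - graded_part k \<zeta> \<in> ext.span ?U" ..
next
  fix \<alpha> assume \<alpha>: "\<alpha> \<in> ext_power k \<and> \<zeta> - \<alpha> \<in> ext.span (\<Union>j\<in>- {k}. ext_power j)"
  have "graded_part k b = 0" if "b \<in> ext.span (\<Union>j\<in>- {k}. ext_power j)" for b :: "'a exterior"
    using that
  proof (induction rule: ext.span_induct_alt)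
    case (step c x y)
    then show ?case by (auto simp: ext_power_eq graded_part_homogeneous)
  qed simp
  then have "graded_part k (\<zeta> - \<alpha>) = 0" using \<alpha> by blast
  moreover have "graded_part k \<alpha> = \<alpha>" using \<alpha> graded_part_homogeneous[of \<alpha> k k] by (simp add: ext_power_eq)
  ultimately show "\<alpha> = graded_part k \<zeta>" by simp
qed

text \<open>
  Anticommuting the repeated vector towards its other occurrence produces its square.
\<close>

lemma ext_word_repeated:
  fixes zs :: "'a::real_inner complexification list"
  assumes "\<not> distinct zs"
  shows "prod_list (map ext_vec zs) = 0"
proof -
  have absorb: "ext_vec z * prod_list (map ext_vec ys) = 0" if "z \<in> set ys"
    for z :: "'a complexification" and ys
    using that
  proof (induction ys)
    case (Cons y ys)
    show ?case
    proof (cases "z = y")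
      case True
      then show ?thesis by (simp add: ext_vec_square flip: mult.assoc)
    next
      case False
      then show ?thesis
        using Cons ext_vec_anticommute[of z y] by (simp add: mult.assoc flip: mult.assoc[of "ext_vec z"])
    qed
  qed simp
  show ?thesis using assms by (induction zs) (auto simp: absorb)
qed

text \<open>
  By multilinearity a product of \<open>n\<close> vectors is a combination of products of \<open>n\<close> elements of \<open>S\<close>, and
  each of these has a repetition.
\<close>

lemma ext_homogeneous_vanish:
  fixes S :: "'a::real_inner complexification set" and a :: "'a exterior"
  assumes S: "finite S" "\<And>z. ext_vec z \<in> ext.span (ext_vec ` S)" and n: "card S < n"
    and a: "a \<in> ext.homogeneous n"
  shows "a = 0"
proof -
  let ?X = "\<lambda>n. {prod_list (map ext_vec ws) |ws. set ws \<subseteq> S \<and> length ws = n}"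
  have word: "prod_list (map ext_vec zs) \<in> ext.span (?X (length zs))" for zs
  proof (induction zs)
    case Nil
    then show ?case by (intro ext.span_base) auto
  next
    case (Cons z zs)
    let ?n = "length zs"
    have gen: "ext_vec s * y \<in> ext.span (?X (Suc ?n))" if s: "s \<in> S" and y: "y \<in> ext.span (?X ?n)" for s y
      using y
    proof (induction rule: ext.span_induct_alt)
      case (step c x y)
      then obtain ws where ws: "x = prod_list (map ext_vec ws)" "set ws \<subseteq> S" "length ws = ?n"
        by blast
      then have "ext_vec s * x = prod_list (map ext_vec (s # ws))" "set (s # ws) \<subseteq> S"
        "length (s # ws) = Suc ?n"
        using s by simp_all
      then have "ext_vec s * x \<in> ?X (Suc ?n)" by blast
      then show ?case
        using step by (simp add: distrib_left ext.scale_mult_right ext.span_add ext.span_scale ext.span_base)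
    qed (simp add: ext.span_zero)
    have "u * prod_list (map ext_vec zs) \<in> ext.span (?X (Suc ?n))" if "u \<in> ext.span (ext_vec ` S)" for u
      using that
    proof (induction rule: ext.span_induct_alt)
      case (step c x y)
      then show ?case
        using gen[OF _ Cons]
        by (auto simp: distrib_right ext.scale_mult_left intro!: ext.span_add ext.span_scale)
    qed (simp add: ext.span_zero)
    then show ?case using S(2) by simp
  qed
  have words_zero: "x = 0" if x: "x \<in> ?X n" for x
  proof -
    obtain ws where ws: "x = prod_list (map ext_vec ws)" "set ws \<subseteq> S" "length ws = n"
      using x by blast
    have "card (set ws) < length ws"
      using card_mono[OF S(1) ws(2)] n ws(3) by simp
    then have "\<not> distinct ws" using distinct_card by force
    then show ?thesis using ws ext_word_repeated by simp
  qed
  have "x = 0" if "x \<in> ext.span (?X n)" for x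
    using that
  proof (induction rule: ext.span_induct_alt)
    case (step c x y)
    then show ?case using words_zero[OF step(1)] by simp
  qed simp
  then have word_zero: "prod_list (map ext_vec zs) = 0" if "length zs = n"
    for zs :: "'a complexification list"
    using word[of zs] that by simp
  show ?thesis
    using a by (induction rule: ext.homogeneous_induct) (simp_all add: word_zero)
qed

section \<open>The Berezin expectation\<close>

lemma (in quadratic_algebra) homogeneous_power:
  "a \<in> homogeneous n \<Longrightarrow> a ^ k \<in> homogeneous (k * n)"
proof (induction k)
  case 0
  then show ?case using word_in_homogeneous[of "[]"] by simp
next
  case (Suc k)
  then show ?case using homogeneous_mult[of a n "a ^ k" "k * n"] by simp
qed

text \<open>
  On an even central element the antiderivation obeys the usual power rule.
\<close>

lemma (in quadratic_algebra) contraction_power: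
  assumes even: "parity a = a" and central: "\<And>b. a * b = b * a"
    and contraction: "contraction x a = u"
  shows "contraction x (a ^ Suc k) = scale (of_nat (Suc k)) (u * a ^ k)"
proof (induction k)
  case 0
  then show ?case by (simp add: contraction)
next
  case (Suc k)
  have "a * (u * a ^ k) = u * a ^ Suc k"
    by (simp only: central[of "u * a ^ k"] mult.assoc power_Suc2)
  then have "contraction x (a ^ Suc (Suc k)) = u * a ^ Suc k + scale (of_nat (Suc k)) (u * a ^ Suc k)"
    using Suc by (simp only: power_Suc[of a "Suc k"] contraction_mult even contraction scale_mult_right)
  moreover have "of_nat (Suc (Suc k)) = 1 + (of_nat (Suc k) :: complex)" by simp
  ultimately show ?case by (simp only: scale_left_distrib scale_one)
qed

context complex_structure
begin

lemma cbilin_negate_plus_plus: "w \<in> eigenspace_plus J \<Longrightarrow> cbilin (negate_plus z) w = cbilin (minus_part z) w"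
  using cbilin_add_left[of "minus_part z" "plus_part z" w]
    eigenspace_plus_isotropic[OF plus_part_in_eigenspace[of z], of w]
  by (simp add: negate_plus_def minus_part_add_plus_part cbilin_add_left cbilin_cscale_left)

lemma cbilin_negate_plus_minus: "w \<in> eigenspace_minus J \<Longrightarrow> cbilin (negate_plus z) w = - cbilin (plus_part z) w"
  using cbilin_add_left[of "minus_part z" "plus_part z" w]
    eigenspace_minus_isotropic[OF minus_part_in_eigenspace[of z], of w]
  by (simp add: negate_plus_def minus_part_add_plus_part cbilin_add_left cbilin_cscale_left)

end

text \<open>
  A unitary basis is fixed in order to compute with \<open>\<gamma>\<close>; the objects themselves do not depend on it.
\<close>

locale unitary_frame = complex_structure J
  for J :: "'a::real_inner \<Rightarrow> 'a" +
  fixes v :: "nat \<Rightarrow> 'a"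
  assumes v: "unitary_basis J v"
begin

abbreviation "M \<equiv> dim_J J"
abbreviation "vplus m \<equiv> gamma_plus J (v m)"
abbreviation "vminus m \<equiv> gamma_minus J (v m)"
abbreviation "neg_gamma \<equiv> - berezin_gamma J"

lemma vplus_mem: "vplus m \<in> eigenspace_plus J" and vminus_mem: "vminus m \<in> eigenspace_minus J"
  by (rule gamma_plus_in_eigenspace[OF orthogonal_complex_structure]
      gamma_minus_in_eigenspace[OF orthogonal_complex_structure])+

lemma cbilin_vminus_vplus:
  "i \<in> {1..M} \<Longrightarrow> j \<in> {1..M} \<Longrightarrow> cbilin (vminus i) (vplus j) = (if i = j then 1 else 0)"
  using v by (simp add: cbilin_commute[of "vminus i"] cbilin_gamma unitary_basis_def)

lemma neg_gamma_eq: "neg_gamma = - (\<Sum>m = 1..M. ext_vec (vplus m) * ext_vec (vminus m))"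
  by (simp add: berezin_gamma_eq[OF v])

lemma neg_gamma_homogeneous: "neg_gamma \<in> ext.homogeneous 2"
proof -
  have "ext_vec (vplus m) * ext_vec (vminus m) \<in> ext.homogeneous 2" for m
    using ext.homogeneous_mult[OF ext.vec_in_homogeneous[of "vplus m"]
        ext.vec_in_homogeneous[of "vminus m"]]
    by (simp add: numeral_2_eq_2)
  then show ?thesis unfolding neg_gamma_eq by (intro ext.homogeneous_closed) simp
qed

lemma homogeneous_vanish:
  fixes a :: "'a exterior"
  assumes k: "2 * M < k" and a: "a \<in> ext.homogeneous k"
  shows "a = 0"
proof -
  let ?S = "vplus ` {1..M} \<union> vminus ` {1..M}"
  have "card ?S \<le> card (vplus ` {1..M}) + card (vminus ` {1..M})" by (rule card_Un_le)
  also have "\<dots> \<le> M + M" by (intro add_mono) (use card_image_le[of "{1..M}"] in force)+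
  finally have card: "card ?S < k" using k by simp
  have "ext_vec z \<in> ext.span (ext_vec ` ?S)" for z
  proof -
    have "ext_vec (plus_part z) \<in> ext.span (ext_vec ` ?S)"
      unfolding ext_vec_plus_expansion[OF v plus_part_in_eigenspace]
      by (intro ext.span_sum ext.span_scale ext.span_base) blast
    moreover have "ext_vec (minus_part z) \<in> ext.span (ext_vec ` ?S)"
      unfolding ext_vec_minus_expansion[OF v minus_part_in_eigenspace]
      by (intro ext.span_sum ext.span_scale ext.span_base) blast
    ultimately have "ext_vec (minus_part z + plus_part z) \<in> ext.span (ext_vec ` ?S)"
      by (simp add: ext.vec_add ext.span_add)
    then show ?thesis by (simp add: minus_part_add_plus_part)
  qed
  from ext_homogeneous_vanish[OF _ this card a] show ?thesis by simp
qed

lemma parity_neg_gamma: "ext.parity neg_gamma = neg_gamma"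
  by (simp add: neg_gamma_eq)

lemma neg_gamma_central: "neg_gamma * a = a * neg_gamma"
proof -
  have "ext_vec (vplus m) * ext_vec (vminus m) * a = a * (ext_vec (vplus m) * ext_vec (vminus m))" for m
    using ext_vec_commute_parity[of "vplus m" "ext.parity a"]
    by (simp add: mult.assoc ext_vec_commute_parity[of "vminus m" a] flip: mult.assoc[of "ext_vec (vplus m)"])
  then show ?thesis by (simp add: neg_gamma_eq sum_distrib_left sum_distrib_right)
qed

text \<open>
  Contracting \<open>v\<^sub>m\<^sup>+ \<and> v\<^sub>m\<^sup>-\<close> with \<open>z\<^sup>- - z\<^sup>+\<close> leaves \<open>(z\<^sup>-|v\<^sub>m\<^sup>+) v\<^sub>m\<^sup>- + (z\<^sup>+|v\<^sub>m\<^sup>-) v\<^sub>m\<^sup>+\<close>, the other pairings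
  being zero by isotropy. The sum over \<open>m\<close> is the expansion of \<open>z\<^sup>- + z\<^sup>+ = z\<close>. The sign of \<open>z\<^sup>+\<close>
  compensates the sign of the antiderivation.
\<close>

lemma contraction_neg_gamma: "ext.contraction (negate_plus z) neg_gamma = - ext_vec z"
proof -
  have "ext.contraction (negate_plus z) (\<Sum>m = 1..M. ext_vec (vplus m) * ext_vec (vminus m)) =
      (\<Sum>m = 1..M. ext_scale (cbilin (minus_part z) (vplus m)) (ext_vec (vminus m)) +
         ext_scale (cbilin (plus_part z) (vminus m)) (ext_vec (vplus m)))"
    by (simp add: cbilin_negate_plus_plus[OF vplus_mem] cbilin_negate_plus_minus[OF vminus_mem]
        ext.scale_mult_right)
  also have "\<dots> = ext_vec (minus_part z) + ext_vec (plus_part z)"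
    by (simp add: sum.distrib ext_vec_plus_expansion[OF v plus_part_in_eigenspace]
        ext_vec_minus_expansion[OF v minus_part_in_eigenspace])
  also have "\<dots> = ext_vec z"
    by (simp add: minus_part_add_plus_part flip: ext.vec_add)
  finally show ?thesis by (simp add: neg_gamma_eq)
qed

lemma contraction_neg_gamma_power:
  "ext.contraction (negate_plus z) (neg_gamma ^ Suc k) =
    ext_scale (of_nat (Suc k)) (- ext_vec z * neg_gamma ^ k)"
  by (rule ext.contraction_power[OF parity_neg_gamma neg_gamma_central contraction_neg_gamma])

definition exp_neg_gamma :: "'a exterior" where
  "exp_neg_gamma = (\<Sum>k\<le>M. ext_scale (1 / fact k) (neg_gamma ^ k))"

lemma neg_gamma_power_homogeneous: "neg_gamma ^ k \<in> ext.homogeneous (2 * k)"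
  using ext.homogeneous_power[OF neg_gamma_homogeneous, of k] by (simp add: mult.commute)

lemma ext_exp_eq: "ext_exp neg_gamma = exp_neg_gamma"
  unfolding ext_exp_def exp_neg_gamma_def
proof (rule sum.mono_neutral_left)
  show "{k. neg_gamma ^ k \<noteq> 0} \<subseteq> {..M}"
    using homogeneous_vanish[OF _ neg_gamma_power_homogeneous] by (force simp: not_le[symmetric])
qed auto

text \<open>
  The differential equation of the exponential. Differentiating the truncated series loses its last
  term, which is harmless because \<open>z \<and> \<gamma>\<^sup>M\<close> has degree \<open>2M + 1\<close>.
\<close>

lemma contraction_exp_neg_gamma:
  "ext.contraction (negate_plus z) exp_neg_gamma = - (ext_vec z * exp_neg_gamma)"
proof -
  have top: "ext_vec z * neg_gamma ^ M = 0"
    using ext.homogeneous_mult[OF ext.vec_in_homogeneous[of z] neg_gamma_power_homogeneous[of M]]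
    by (intro homogeneous_vanish[of "1 + 2 * M"]) simp_all
  have "ext.contraction (negate_plus z) exp_neg_gamma =
      (\<Sum>k\<le>M. ext_scale (1 / fact k) (ext.contraction (negate_plus z) (neg_gamma ^ k)))"
    by (simp add: exp_neg_gamma_def)
  also have "\<dots> = (\<Sum>k<M. ext_scale (1 / fact (Suc k))
      (ext.contraction (negate_plus z) (neg_gamma ^ Suc k)))"
    by (simp only: lessThan_Suc_atMost[symmetric] sum.lessThan_Suc_shift) simp
  also have "\<dots> = (\<Sum>k<M. - ext_scale (1 / fact k) (ext_vec z * neg_gamma ^ k))"
  proof (intro sum.cong refl)
    fix k
    have "1 / fact (Suc k) * of_nat (Suc k) = (1 / fact k :: complex)"
      by (simp add: field_simps del: of_nat_Suc)
    then show "ext_scale (1 / fact (Suc k)) (ext.contraction (negate_plus z) (neg_gamma ^ Suc k)) =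
        - ext_scale (1 / fact k) (ext_vec z * neg_gamma ^ k)"
      by (simp only: contraction_neg_gamma_power mult_minus_left ext.scale_minus_right ext.scale_scale)
  qed
  also have "\<dots> = - (ext_vec z * (\<Sum>k<M. ext_scale (1 / fact k) (neg_gamma ^ k)))"
    by (simp add: sum_negf sum_distrib_left ext.scale_mult_right)
  also have "ext_vec z * (\<Sum>k<M. ext_scale (1 / fact k) (neg_gamma ^ k)) = ext_vec z * exp_neg_gamma"
    by (simp add: exp_neg_gamma_def lessThan_Suc_atMost[symmetric] distrib_left ext.scale_mult_right top)
  finally show ?thesis .
qed

text \<open>
  Only degree \<open>2M + 1\<close>, which is zero, could contribute.
\<close>

lemma graded_part_top_contraction:
  fixes a :: "'a exterior"
  shows "graded_part (2 * M) (ext.contraction x a) = 0"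
proof (induction a rule: ext.word_induct)
  case (step c zs b)
  have "graded_part (2 * M) (ext.contraction x (prod_list (map ext_vec zs))) = 0"
  proof (cases "length zs - 1 = 2 * M \<and> zs \<noteq> []")
    case True
    then have "prod_list (map ext_vec zs) = 0"
      using homogeneous_vanish[OF _ ext.word_in_homogeneous[of zs]] by (cases zs) auto
    then show ?thesis by simp
  next
    case False
    then show ?thesis
      using graded_part_homogeneous[OF ext.contraction_word[of x zs], of "2 * M"]
      by (cases "zs = []") auto
  qed
  then show ?case using step by simp
qed simp

text \<open>
  Integration by parts.
\<close>

lemma graded_part_vec_mult_exp:
  "graded_part (2 * M) (ext_vec z * a * exp_neg_gamma) =
   graded_part (2 * M) (ext.contraction (negate_plus z) a * exp_neg_gamma)"
proof -
  have "ext.contraction (negate_plus z) (a * exp_neg_gamma) =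
      ext.contraction (negate_plus z) a * exp_neg_gamma - ext_vec z * a * exp_neg_gamma"
    using ext_vec_commute_parity[of z a]
    by (simp add: ext.contraction_mult contraction_exp_neg_gamma flip: mult.assoc)
  then show ?thesis using graded_part_top_contraction[of "negate_plus z" "a * exp_neg_gamma"] by simp
qed

lemma omega_eq: "berezin_omega J = graded_part (2 * M) exp_neg_gamma"
proof -
  have "graded_part (2 * M) exp_neg_gamma =
      (\<Sum>k\<le>M. if k = M then ext_scale (1 / fact k) (neg_gamma ^ k) else 0)"
    unfolding exp_neg_gamma_def graded_part_linear
    by (intro sum.cong refl) (simp add: graded_part_homogeneous[OF neg_gamma_power_homogeneous])
  then show ?thesis by (simp add: berezin_omega_def)
qed

text \<open>
  The difference of the two sides satisfies the contraction recursion for \<open>z\<^sup>- - z\<^sup>+\<close> and vanishes at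
  \<open>1\<close>.
\<close>

lemma graded_part_mult_exp:
  "graded_part (2 * M) (\<zeta> * exp_neg_gamma) = ext_scale (cliff_trace (nu \<zeta>)) (berezin_omega J)"
proof -
  have hom: "module_hom cliff_scale (*) (cliff_trace :: 'a clifford \<Rightarrow> complex)"
    "cliff_trace (1 :: 'a clifford) = 1"
    using is_trace_cliff_trace unfolding is_trace_def Vector_Spaces.linear_def by blast+
  define D where "D \<zeta> = graded_part (2 * M) (\<zeta> * exp_neg_gamma) -
      ext_scale (cliff_trace (nu \<zeta>)) (berezin_omega J)" for \<zeta>
  have "Vector_Spaces.linear ext_scale ext_scale D"
    by (simp add: Vector_Spaces.linear_iff ext.vector_space_axioms D_def distrib_right
        ext.scale_mult_left module_hom.add[OF hom(1)] module_hom.scale[OF hom(1)]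
        ext.scale_left_distrib ext.scale_right_diff_distrib)
  then have "D \<zeta> = 0"
  proof (rule ext.contraction_recursion_unique[where K = negate_plus])
    show "D 1 = 0" by (simp add: D_def omega_eq hom)
    show "D (ext_vec z * a) = D (ext.contraction (negate_plus z) a)" for z a
      by (simp only: D_def graded_part_vec_mult_exp trace_nu_vec_mult)
  qed
  then show ?thesis by (simp add: D_def)
qed

lemma negate_plus_minus: "w \<in> eigenspace_minus J \<Longrightarrow> negate_plus w = w"
  by (simp add: negate_plus_def plus_part_minus cscale_def zero_prod_def)

text \<open>
  By the recursion, the first vector \<open>v\<^sub>m\<^sup>-\<close> contracts only with its partner \<open>v\<^sub>m\<^sup>+\<close>, being
  orthogonal to all later vectors; so a pair can be removed without changing the value.
\<close>

lemma trace_nu_pairs: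
  assumes "distinct ms" "set ms \<subseteq> {1..M}"
  shows "cliff_trace (nu (prod_list (map ext_vec (concat (map (\<lambda>m. [vminus m, vplus m]) ms))))) = 1"
  using assms
proof (induction ms)
  case Nil
  then show ?case using is_trace_cliff_trace[where 'a = 'a] by (simp add: is_trace_def)
next
  case (Cons m ms)
  let ?zs = "concat (map (\<lambda>m. [vminus m, vplus m]) ms)"
  have "cbilin (vminus m) z = 0" if "z \<in> set ?zs" for z
    using that Cons.prems
    by (auto simp: cbilin_vminus_vplus eigenspace_minus_isotropic[OF vminus_mem vminus_mem])
  then have "ext.contraction (vminus m) (prod_list (map ext_vec ?zs)) = 0"
    by (rule ext.contraction_word_orthogonal)
  then show ?case
    using Cons by (simp add: trace_nu_vec_mult negate_plus_minus[OF vminus_mem] cbilin_vminus_vplus)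
qed

text \<open>
  The product \<open>t\<close> of all pairs has top degree, so \<open>t \<and> e\<^sup>-\<^sup>\<gamma> = t\<close> and \<open>graded_part_mult_exp\<close> reads
  \<open>t = \<tau>(\<nu>(t)) \<omega>\<close> with \<open>\<tau>(\<nu>(t)) = 1\<close>. If \<open>\<omega>\<close> were zero, so would be \<open>t\<close>, contradicting the value
  of \<open>\<tau>(\<nu>(t))\<close>.
\<close>

lemma omega_nonzero: "berezin_omega J \<noteq> 0"
proof
  assume omega: "berezin_omega J = 0"
  let ?zs = "concat (map (\<lambda>m. [vminus m, vplus m]) [1..<Suc M])"
  define t where "t = prod_list (map ext_vec ?zs)"
  have "length ?zs = 2 * M" by (simp add: length_concat comp_def sum_list_triv)
  then have t_top: "t \<in> ext.homogeneous (2 * M)"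
    using ext.word_in_homogeneous[of ?zs] by (simp add: t_def)
  have "t * neg_gamma ^ k = (if k = 0 then t else 0)" for k
  proof (cases "k = 0")
    case False
    then show ?thesis
      using homogeneous_vanish[OF _ ext.homogeneous_mult[OF t_top neg_gamma_power_homogeneous[of k]]] by simp
  qed simp
  then have "t * exp_neg_gamma = (\<Sum>k\<le>M. ext_scale (1 / fact k) (if k = 0 then t else 0))"
    by (simp add: exp_neg_gamma_def sum_distrib_left ext.scale_mult_right)
  also have "\<dots> = t"
    by (subst sum.remove[of _ 0]) auto
  finally have "t = graded_part (2 * M) (t * exp_neg_gamma)"
    using graded_part_homogeneous[OF t_top, of "2 * M"] by simp
  then have "t = 0" using graded_part_mult_exp[of t] omega by simp
  moreover have "cliff_trace (nu t) = 1"
    unfolding t_def by (rule trace_nu_pairs) auto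
  moreover have "cliff_trace (0 :: 'a clifford) = 0"
    using is_trace_cliff_trace
    by (auto simp: is_trace_def Vector_Spaces.linear_def intro: module_hom.zero)
  ultimately show False by simp
qed

lemma berezin_expectation_eq: "berezin_expectation J \<zeta> = cliff_trace (antinormal J \<zeta>)"
  unfolding berezin_expectation_def ext_component_eq ext_exp_eq graded_part_mult_exp antinormal_eq
  by (simp add: omega_nonzero)

end

theorem theorem4:
  fixes J :: "'a::real_inner \<Rightarrow> 'a"
  assumes "\<exists>B :: 'a set. finite B \<and> span B = UNIV"
    and "orthogonal_complex_structure J"
  shows "berezin_expectation J = cliff_trace \<circ> antinormal J"
proof -
  interpret complex_structure J by unfold_locales fact
  obtain v where "unitary_basis J v" using unitary_basis_exists[OF assms(1)] by blast
  then interpret unitary_frame J v by unfold_locales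
  show ?thesis by (simp add: fun_eq_iff berezin_expectation_eq)
qed

end
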